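(* For any $p\in[1,\infty)$, the operator $\overline{\mathcal{D}_\delta}:L^p(\Omega_\delta)\to L^p(\Omega_\delta)$ is compact if and only if $\mu_\delta$ integrates to zero, i.e. $\int_{B_\delta(0)}\mu_\delta(z)\,dz=0$.
   Context: $\Omega\subseteq\mathbb{R}^d$ is nonempty, open and bounded, $\delta>0$, and $\mu_\delta\in L^1(\mathbb{R}^d)$ is a real-valued kernel with $\operatorname{supp}(\mu_\delta)\subseteq\overline{B_\delta(0)}$ (no symmetry is assumed). The collar is $\Gamma_\delta=\left(\bigcup_{x\in\Omega}\overline{B_\delta(x)}\right)\setminus\Omega$, and $\Omega_\delta=\Omega\cup\Gamma_\delta$. The extended nonlocal derivative is, for $u\in L^p(\Omega_\delta)$ and $x\in\Omega_\delta$, $$\overline{\mathcal{D}_\delta}u(x)=\int_{\Omega_\delta}[u(y)-u(x)]\,\mu_\delta(y-x)\,\chi_{B_\delta(x)}(y)\,\chi_\Omega(x)\,dy,$$ so $\overline{\mathcal{D}_\delta}u=0$ on $\Gamma_\delta$. *)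

theory Defs
  imports "HOL-Analysis.Analysis"
begin

section \<open>The Banach spaces \<open>L\<^sup>p\<close> as spaces of equivalence classes\<close>

definition Lp_fun :: "real \<Rightarrow> 'a measure \<Rightarrow> ('a \<Rightarrow> real) set" where
  "Lp_fun p M = {u \<in> borel_measurable M. integrable M (\<lambda>x. \<bar>u x\<bar> powr p)}"

definition Lp_norm :: "real \<Rightarrow> 'a measure \<Rightarrow> ('a \<Rightarrow> real) \<Rightarrow> real" where
  "Lp_norm p M u = (\<integral>x. \<bar>u x\<bar> powr p \<partial>M) powr (1 / p)"

text \<open>The quantifier \<open>AE x in M\<close> only sees points of \<open>space M\<close>, so the values of a function outside
  \<open>space M\<close> are irrelevant to its class.\<close>

definition Lp_rel :: "real \<Rightarrow> 'a measure \<Rightarrow> (('a \<Rightarrow> real) \<times> ('a \<Rightarrow> real)) set" where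
  "Lp_rel p M = {(u, v). u \<in> Lp_fun p M \<and> v \<in> Lp_fun p M \<and> (AE x in M. u x = v x)}"

definition Lp_space :: "real \<Rightarrow> 'a measure \<Rightarrow> ('a \<Rightarrow> real) set set" where
  "Lp_space p M = Lp_fun p M // Lp_rel p M"

definition Lp_rep :: "('a \<Rightarrow> real) set \<Rightarrow> 'a \<Rightarrow> real" where
  "Lp_rep A = (SOME u. u \<in> A)"

definition Lp_dist :: "real \<Rightarrow> 'a measure \<Rightarrow> ('a \<Rightarrow> real) set \<Rightarrow> ('a \<Rightarrow> real) set \<Rightarrow> real" where
  "Lp_dist p M A B = Lp_norm p M (\<lambda>x. Lp_rep A x - Lp_rep B x)"


section \<open>Linear and compact operators on \<open>L\<^sup>p\<close>\<close>

text \<open>A map \<open>T\<close> on functions induces a linear operator \<open>L\<^sup>p \<rightarrow> L\<^sup>p\<close>: it preserves \<open>L\<^sup>p\<close>, respects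
  equality almost everywhere, and is linear up to equality almost everywhere.\<close>

definition Lp_linear_operator :: "real \<Rightarrow> 'a measure \<Rightarrow> (('a \<Rightarrow> real) \<Rightarrow> ('a \<Rightarrow> real)) \<Rightarrow> bool" where
  "Lp_linear_operator p M T \<longleftrightarrow>
     (\<forall>u \<in> Lp_fun p M. T u \<in> Lp_fun p M) \<and>
     (\<forall>u \<in> Lp_fun p M. \<forall>v \<in> Lp_fun p M.
        (AE x in M. u x = v x) \<longrightarrow> (AE x in M. T u x = T v x)) \<and>
     (\<forall>u \<in> Lp_fun p M. \<forall>v \<in> Lp_fun p M.
        AE x in M. T (\<lambda>y. u y + v y) x = T u x + T v x) \<and>
     (\<forall>c. \<forall>u \<in> Lp_fun p M. AE x in M. T (\<lambda>y. c * u y) x = c * T u x)"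

definition Lp_induced ::
  "real \<Rightarrow> 'a measure \<Rightarrow> (('a \<Rightarrow> real) \<Rightarrow> ('a \<Rightarrow> real)) \<Rightarrow> ('a \<Rightarrow> real) set \<Rightarrow> ('a \<Rightarrow> real) set" where
  "Lp_induced p M T A = (\<Union>u\<in>A. Lp_rel p M `` {T u})"

text \<open>Compactness of the operator induced by \<open>T\<close>: images of bounded sets are relatively compact in the
  norm topology. Linearity and well-definedness on classes are \<open>Lp_linear_operator\<close>.\<close>

definition Lp_compact_operator :: "real \<Rightarrow> 'a measure \<Rightarrow> (('a \<Rightarrow> real) \<Rightarrow> ('a \<Rightarrow> real)) \<Rightarrow> bool" where
  "Lp_compact_operator p M T \<longleftrightarrow>
     (let X = Lp_space p M; d = Lp_dist p M; \<tau> = Metric_space.mtopology X d in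
      \<forall>S \<subseteq> X. Metric_space.mbounded X d S \<longrightarrow>
        compactin \<tau> (\<tau> closure_of (Lp_induced p M T ` S)))"


section \<open>The nonlocal derivative\<close>

text \<open>The support of a function that is only determined almost everywhere: the complement of the
  largest open set on which it vanishes almost everywhere.\<close>

definition ess_support :: "('a::euclidean_space \<Rightarrow> real) \<Rightarrow> 'a set" where
  "ess_support f = - \<Union>{U. open U \<and> (AE x in lebesgue. x \<in> U \<longrightarrow> f x = 0)}"

definition collar :: "real \<Rightarrow> 'a::euclidean_space set \<Rightarrow> 'a set" where
  "collar \<delta> \<Omega> = (\<Union>x\<in>\<Omega>. cball x \<delta>) - \<Omega>"

definition extended_domain :: "real \<Rightarrow> 'a::euclidean_space set \<Rightarrow> 'a set" where
  "extended_domain \<delta> \<Omega> = \<Omega> \<union> collar \<delta> \<Omega>"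

text \<open>For \<open>u\<close> in \<open>L\<^sup>p\<close> and an integrable kernel the integrand below is integrable for almost every
  \<open>x\<close>; at the exceptional points the integral is \<open>0\<close> by the library's convention.\<close>

definition nonlocal_deriv ::
  "real \<Rightarrow> 'a::euclidean_space set \<Rightarrow> ('a \<Rightarrow> real) \<Rightarrow> ('a \<Rightarrow> real) \<Rightarrow> 'a \<Rightarrow> real" where
  "nonlocal_deriv \<delta> \<Omega> \<mu> u x =
     (LINT y:extended_domain \<delta> \<Omega>|lebesgue.
        (u y - u x) * \<mu> (y - x) * indicator (ball x \<delta>) y * indicator \<Omega> x)"


section \<open>\<open>L\<^sup>p\<close> is a metric space\<close>

lemma powr_abs_convex_bound:
  fixes a b s t p :: real
  assumes p: "p \<ge> 1" and s: "s > 0" and t: "t > 0"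
  shows "\<bar>a + b\<bar> powr p
           \<le> (s + t) powr p * (s / (s + t) * \<bar>a / s\<bar> powr p + t / (s + t) * \<bar>b / t\<bar> powr p)"
proof -
  let ?x = "\<bar>a / s\<bar>" and ?y = "\<bar>b / t\<bar>"
  have cv: "(\<alpha> * x + \<beta> * y) powr p \<le> \<alpha> * x powr p + \<beta> * y powr p"
    if xy: "x \<ge> 0" "y \<ge> 0" and ab: "\<alpha> > 0" "\<beta> > 0" "\<alpha> + \<beta> = 1" for x y \<alpha> \<beta> :: real
  proof -
    have sc: "(\<gamma> * z) powr p \<le> \<gamma> * z powr p" if "0 < \<gamma>" "\<gamma> \<le> 1" "0 \<le> z" for \<gamma> z :: real
      using that p powr_mono'[of 1 p \<gamma>] by (simp add: powr_mult mult_right_mono)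
    consider "x = 0" | "y = 0" | "x > 0" "y > 0" using xy by linarith
    then show ?thesis
    proof cases
      case 1 then show ?thesis using sc[of \<beta> y] xy ab by auto
    next
      case 2 then show ?thesis using sc[of \<alpha> x] xy ab by auto
    next
      case 3
      then show ?thesis
        using convex_onD[OF powr_convex[OF p], of \<beta> x y] ab by (simp add: eq_diff_eq[symmetric])
    qed
  qed
  have "\<bar>a + b\<bar> \<le> (s + t) * (s / (s + t) * ?x + t / (s + t) * ?y)"
    using s t abs_triangle_ineq[of a b] by (simp add: distrib_left)
  then have "\<bar>a + b\<bar> powr p \<le> ((s + t) * (s / (s + t) * ?x + t / (s + t) * ?y)) powr p"
    using p by (intro powr_mono2) auto
  also have "\<dots> = (s + t) powr p * (s / (s + t) * ?x + t / (s + t) * ?y) powr p"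
    using s t by (simp add: powr_mult)
  also have "\<dots> \<le> (s + t) powr p * (s / (s + t) * ?x powr p + t / (s + t) * ?y powr p)"
    using s t by (intro mult_left_mono cv) (auto simp flip: add_divide_distrib)
  finally show ?thesis .
qed

lemma Lp_fun_scale: "u \<in> Lp_fun p M \<Longrightarrow> (\<lambda>x. c * u x) \<in> Lp_fun p M"
  by (auto simp: Lp_fun_def abs_mult powr_mult)

lemma Lp_fun_add:
  assumes "p \<ge> 1" "u \<in> Lp_fun p M" "v \<in> Lp_fun p M"
  shows "(\<lambda>x. u x + v x) \<in> Lp_fun p M"
proof -
  have [measurable]: "u \<in> borel_measurable M" "v \<in> borel_measurable M"
    and iu: "integrable M (\<lambda>x. \<bar>u x\<bar> powr p)" and iv: "integrable M (\<lambda>x. \<bar>v x\<bar> powr p)"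
    using assms by (auto simp: Lp_fun_def)
  have "integrable M (\<lambda>x. (1 + 1) powr p *
          (1 / (1 + 1) * \<bar>u x / 1\<bar> powr p + 1 / (1 + 1) * \<bar>v x / 1\<bar> powr p))"
    using iu iv by (intro integrable_mult_right Bochner_Integration.integrable_add) auto
  then have "integrable M (\<lambda>x. \<bar>u x + v x\<bar> powr p)"
    by (rule Bochner_Integration.integrable_bound)
       (use powr_abs_convex_bound[OF assms(1), of 1 1] in \<open>auto intro!: AE_I2 order_trans[OF _ abs_ge_self]\<close>)
  then show ?thesis by (auto simp: Lp_fun_def)
qed

lemma Lp_fun_diff:
  assumes "p \<ge> 1" "u \<in> Lp_fun p M" "v \<in> Lp_fun p M"
  shows "(\<lambda>x. u x - v x) \<in> Lp_fun p M"
  using Lp_fun_add[OF assms(1,2) Lp_fun_scale[OF assms(3), of "-1"]] by simp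

lemma Lp_norm_powr:
  assumes "p \<ge> 1"
  shows "Lp_norm p M u powr p = (\<integral>x. \<bar>u x\<bar> powr p \<partial>M)"
  using assms by (simp add: Lp_norm_def powr_powr powr_one_gt_zero_iff integral_nonneg_AE)

lemma Lp_norm_add:
  assumes p: "p \<ge> 1" and u: "u \<in> Lp_fun p M" and v: "v \<in> Lp_fun p M"
  shows "Lp_norm p M (\<lambda>x. u x + v x) \<le> Lp_norm p M u + Lp_norm p M v"
proof -
  have iu: "integrable M (\<lambda>x. \<bar>u x\<bar> powr p)" and iv: "integrable M (\<lambda>x. \<bar>v x\<bar> powr p)"
    and iuv: "integrable M (\<lambda>x. \<bar>u x + v x\<bar> powr p)"
    using u v Lp_fun_add[OF p u v] by (auto simp: Lp_fun_def)
  have le: "Lp_norm p M (\<lambda>x. u x + v x) \<le> s + t"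
    if s: "s > Lp_norm p M u" and t: "t > Lp_norm p M v" for s t
  proof -
    have nn: "0 \<le> Lp_norm p M u" "0 \<le> Lp_norm p M v" by (auto simp: Lp_norm_def)
    then have st: "s > 0" "t > 0" using s t by linarith+
    have *: "(\<integral>x. \<bar>w x / r\<bar> powr p \<partial>M) \<le> 1" if "r > Lp_norm p M w" "r > 0" for r w
    proof -
      have "(\<integral>x. \<bar>w x / r\<bar> powr p \<partial>M) = Lp_norm p M w powr p / r powr p"
        using that by (simp add: Lp_norm_powr[OF p] powr_divide abs_divide)
      also have "\<dots> \<le> 1"
        using that p by (auto simp: Lp_norm_def intro!: powr_mono2)
      finally show ?thesis .
    qed
    have iu': "integrable M (\<lambda>x. \<bar>u x / s\<bar> powr p)" and iv': "integrable M (\<lambda>x. \<bar>v x / t\<bar> powr p)"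
      using iu iv st by (auto simp: abs_divide powr_divide)
    have "(\<integral>x. \<bar>u x + v x\<bar> powr p \<partial>M) \<le>
      (\<integral>x. (s + t) powr p * (s / (s + t) * \<bar>u x / s\<bar> powr p + t / (s + t) * \<bar>v x / t\<bar> powr p) \<partial>M)"
      using iu' iv' by (intro integral_mono iuv powr_abs_convex_bound[OF p st])
        (intro integrable_mult_right Bochner_Integration.integrable_add)
    also have "\<dots> = (s + t) powr p * (s / (s + t) * (\<integral>x. \<bar>u x / s\<bar> powr p \<partial>M)
                                   + t / (s + t) * (\<integral>x. \<bar>v x / t\<bar> powr p \<partial>M))"
      using iu' iv' by (simp only: integral_mult_right_zero Bochner_Integration.integral_add integrable_mult_right)
    also have "\<dots> \<le> (s + t) powr p * (s / (s + t) * 1 + t / (s + t) * 1)"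
      using st *[OF s] *[OF t] by (intro mult_left_mono add_mono) auto
    also have "\<dots> = (s + t) powr p" using st by (simp add: add_divide_distrib[symmetric])
    finally have "(\<integral>x. \<bar>u x + v x\<bar> powr p \<partial>M) powr (1 / p) \<le> ((s + t) powr p) powr (1 / p)"
      using p by (intro powr_mono2) (auto intro!: integral_nonneg_AE)
    then show ?thesis using st p by (simp add: Lp_norm_def powr_powr)
  qed
  show ?thesis
  proof (rule field_le_epsilon)
    fix e :: real assume "e > 0"
    then show "Lp_norm p M (\<lambda>x. u x + v x) \<le> Lp_norm p M u + Lp_norm p M v + e"
      using le[of "Lp_norm p M u + e / 2" "Lp_norm p M v + e / 2"] by simp
  qed
qed

lemma Lp_norm_eq_0_iff:
  assumes "u \<in> Lp_fun p M"
  shows "Lp_norm p M u = 0 \<longleftrightarrow> (AE x in M. u x = 0)"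
proof -
  have "Lp_norm p M u = 0 \<longleftrightarrow> (\<integral>x. \<bar>u x\<bar> powr p \<partial>M) = 0" by (simp add: Lp_norm_def)
  also have "\<dots> \<longleftrightarrow> (AE x in M. \<bar>u x\<bar> powr p = 0)"
    using assms by (intro integral_nonneg_eq_0_iff_AE) (auto simp: Lp_fun_def)
  finally show ?thesis by simp
qed

lemma equiv_Lp_rel: "equiv (Lp_fun p M) (Lp_rel p M)"
  by (intro equivI refl_onI symI transI) (auto simp: Lp_rel_def)

lemma Lp_rep_in:
  assumes "A \<in> Lp_space p M"
  shows "Lp_rep A \<in> A" "Lp_rep A \<in> Lp_fun p M"
proof -
  show *: "Lp_rep A \<in> A"
    using in_quotient_imp_non_empty[OF equiv_Lp_rel assms[unfolded Lp_space_def]]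
    by (auto simp: Lp_rep_def some_in_eq)
  show "Lp_rep A \<in> Lp_fun p M"
    using in_quotient_imp_subset[OF equiv_Lp_rel assms[unfolded Lp_space_def]] * by auto
qed

lemma Metric_space_Lp:
  assumes p: "p \<ge> 1"
  shows "Metric_space (Lp_space p M) (Lp_dist p M)"
proof
  show "0 \<le> Lp_dist p M A B" for A B by (simp add: Lp_dist_def Lp_norm_def)
  show "Lp_dist p M A B = Lp_dist p M B A" for A B
    by (simp add: Lp_dist_def Lp_norm_def abs_minus_commute)
next
  fix A B assume AB: "A \<in> Lp_space p M" "B \<in> Lp_space p M"
  have "Lp_dist p M A B = 0 \<longleftrightarrow> (AE x in M. Lp_rep A x = Lp_rep B x)"
    using Lp_norm_eq_0_iff[OF Lp_fun_diff[OF p Lp_rep_in(2) Lp_rep_in(2)], OF AB]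
    by (simp add: Lp_dist_def)
  also have "\<dots> \<longleftrightarrow> (Lp_rep A, Lp_rep B) \<in> Lp_rel p M"
    using Lp_rep_in(2) AB by (auto simp: Lp_rel_def)
  also have "\<dots> \<longleftrightarrow> A = B"
    using quotient_eq_iff[OF equiv_Lp_rel] AB Lp_rep_in(1) by (metis Lp_space_def)
  finally show "Lp_dist p M A B = 0 \<longleftrightarrow> A = B" .
next
  fix A B C assume "A \<in> Lp_space p M" "B \<in> Lp_space p M" "C \<in> Lp_space p M"
  note in_fun = this[THEN Lp_rep_in(2)]
  show "Lp_dist p M A C \<le> Lp_dist p M A B + Lp_dist p M B C"
    using Lp_norm_add[OF p Lp_fun_diff[OF p in_fun(1,2)] Lp_fun_diff[OF p in_fun(2,3)]]
    by (simp add: Lp_dist_def)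
qed

end

theory Submission
  imports Defs
begin

text \<open>
  Write \<open>E = \<Omega>\<^sub>\<delta>\<close>, let \<open>k\<close> be \<open>\<mu>\<close> cut off to \<open>ball 0 \<delta>\<close>, and let \<open>c\<close> be the integral of \<open>k\<close>. Splitting
  the difference \<open>u y - u x\<close> shows that almost everywhere
  \<open>nonlocal_deriv \<delta> \<Omega> \<mu> u x = indicator \<Omega> x * (correlation E k u x - c * u x)\<close>,
  where \<open>correlation E k\<close> is the integral operator \<open>u \<mapsto> \<integral>\<^sub>E u y k (y - x) dy\<close>
  (\<open>nonlocal_deriv_AE_eq\<close>). So the derivative is a correlation operator minus \<open>c\<close> times the restriction
  to \<open>\<Omega>\<close>, and everything depends on which of these two parts is compact.

  The correlation part is always compact (\<open>Lp_precompact_on_correlation\<close>). By Young's inequality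
  its operator norm on \<open>L\<^sup>p\<close> is at most the \<open>L\<^sup>1\<close> norm of \<open>k\<close>, and Lipschitz kernels are dense in \<open>L\<^sup>1\<close>
  (\<open>lipschitz_dense_in_L1\<close>), so it is a norm limit of correlation operators with Lipschitz kernels.
  Such an operator maps a bounded set to functions that are uniformly bounded and uniformly
  Lipschitz on the bounded set \<open>E\<close>; up to a small uniform error they are determined by their rounded values
  on a finite net, which leaves finitely many possibilities.

  Hence the derivative is compact if \<open>c = 0\<close>. If it is compact and \<open>c \<noteq> 0\<close>, then multiplication by
  \<open>c\<close> on \<open>\<Omega>\<close> is a difference of two compact operators. This is impossible, because \<open>\<Omega>\<close> contains infinitely many
  disjoint annuli, whose normalised indicators are a bounded sequence with mutual distances
  at least 1 (\<open>unit_functions_disjoint_supports\<close>).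

  Compactness is handled at the level of functions. Since \<open>L\<^sup>p\<close> is complete (\<open>Lp_complete\<close>), a set
  of classes has compact closure exactly if it is totally bounded, and the latter is the property
  \<open>Lp_precompact_on\<close>, which involves representatives only (\<open>Lp_compact_operator_iff\<close>).
\<close>

section \<open>The Banach space \<open>L\<^sup>p\<close> and its compact operators\<close>

lemma Lp_norm_nonneg [simp]: "0 \<le> Lp_norm p M u"
  by (simp add: Lp_norm_def)

lemma Lp_norm_minus_commute: "Lp_norm p M (\<lambda>x. u x - v x) = Lp_norm p M (\<lambda>x. v x - u x)"
  by (simp add: Lp_norm_def abs_minus_commute)

lemma Lp_norm_scale:
  assumes "1 \<le> p"
  shows "Lp_norm p M (\<lambda>x. c * u x) = \<bar>c\<bar> * Lp_norm p M u"
  using assms by (simp add: Lp_norm_def abs_mult powr_mult powr_powr integral_nonneg_AE)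

lemma Lp_norm_diff_le:
  assumes "1 \<le> p" "u \<in> Lp_fun p M" "v \<in> Lp_fun p M"
  shows "Lp_norm p M (\<lambda>x. u x - v x) \<le> Lp_norm p M u + Lp_norm p M v"
  using Lp_norm_add[OF assms(1,2) Lp_fun_scale[OF assms(3), of "-1"]] Lp_norm_scale[OF assms(1), of M "-1" v]
  by simp

lemma Lp_norm_cong_AE:
  assumes "u \<in> Lp_fun p M" "v \<in> Lp_fun p M" "AE x in M. u x = v x"
  shows "Lp_norm p M u = Lp_norm p M v"
proof -
  have "(\<integral>x. \<bar>u x\<bar> powr p \<partial>M) = (\<integral>x. \<bar>v x\<bar> powr p \<partial>M)"
    using assms by (intro integral_cong_AE) (auto simp: Lp_fun_def)
  then show ?thesis by (simp add: Lp_norm_def)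
qed

lemma Lp_norm_le_of_abs_le:
  assumes p: "1 \<le> p" and u: "u \<in> borel_measurable M" and v: "v \<in> Lp_fun p M"
    and le: "\<And>x. x \<in> space M \<Longrightarrow> \<bar>u x\<bar> \<le> \<bar>v x\<bar>"
  shows "u \<in> Lp_fun p M" "Lp_norm p M u \<le> Lp_norm p M v"
proof -
  have iv: "integrable M (\<lambda>x. \<bar>v x\<bar> powr p)" using v by (simp add: Lp_fun_def)
  have le': "\<bar>u x\<bar> powr p \<le> \<bar>v x\<bar> powr p" if "x \<in> space M" for x
    using le[OF that] p by (intro powr_mono2) auto
  have iu: "integrable M (\<lambda>x. \<bar>u x\<bar> powr p)"
    using u le' by (intro Bochner_Integration.integrable_bound[OF iv]) (auto intro!: AE_I2)
  then show "u \<in> Lp_fun p M" using u by (simp add: Lp_fun_def)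
  show "Lp_norm p M u \<le> Lp_norm p M v"
    unfolding Lp_norm_def using integral_mono[OF iu iv le'] p by (intro powr_mono2) (auto intro!: integral_nonneg_AE)
qed

lemma Lp_norm_le_iff:
  assumes "1 \<le> p" "0 \<le> c"
  shows "Lp_norm p M u \<le> c \<longleftrightarrow> (\<integral>x. \<bar>u x\<bar> powr p \<partial>M) \<le> c powr p"
proof -
  have "Lp_norm p M u \<le> c \<longleftrightarrow> Lp_norm p M u powr p \<le> c powr p"
    using assms by (smt (verit) Lp_norm_nonneg powr_less_mono2 powr_mono2)
  then show ?thesis by (simp add: Lp_norm_powr[OF assms(1), of M u])
qed

text \<open>By monotone convergence the sum of the integrals of \<open>\<bar>2 ^ k * h k\<bar> powr p\<close> is finite, so at almost
  every point these terms are eventually below 1, and \<open>h k\<close> is dominated by a geometric series. The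
  factor \<open>2 ^ k\<close> replaces Minkowski's inequality for infinite sums.\<close>

lemma AE_summable_of_geometric_Lp_norm:
  fixes h :: "nat \<Rightarrow> 'a \<Rightarrow> real"
  assumes p: "1 \<le> p" and h: "\<And>k. h k \<in> Lp_fun p M"
    and small: "\<And>k. Lp_norm p M (h k) \<le> (1/4) ^ k"
  shows "AE x in M. summable (\<lambda>k. \<bar>h k x\<bar>)"
proof -
  have [measurable]: "h k \<in> borel_measurable M" for k using h by (simp add: Lp_fun_def)
  define q where "q k x = \<bar>2 ^ k * h k x\<bar> powr p" for k x
  have q_meas [measurable]: "q k \<in> borel_measurable M" for k unfolding q_def by measurable
  have q_int: "(\<integral>\<^sup>+x. ennreal (q k x) \<partial>M) \<le> ennreal ((1/2) ^ k)" for k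
  proof -
    have sc: "(\<lambda>x. 2 ^ k * h k x) \<in> Lp_fun p M" by (rule Lp_fun_scale[OF h])
    have "Lp_norm p M (\<lambda>x. 2 ^ k * h k x) \<le> 2 ^ k * (1/4) ^ k"
      using small[of k] by (simp add: Lp_norm_scale[OF p])
    also have "\<dots> = (1/2) ^ k" by (simp flip: power_mult_distrib)
    finally have "integral\<^sup>L M (q k) \<le> ((1/2) ^ k) powr p"
      using Lp_norm_le_iff[OF p, of "(1/2) ^ k" M "\<lambda>x. 2 ^ k * h k x"] by (simp add: q_def[abs_def])
    also have "\<dots> \<le> ((1/2) ^ k) powr 1"
      by (rule powr_mono') (use p in \<open>auto simp: power_le_one\<close>)
    finally have "integral\<^sup>L M (q k) \<le> (1/2) ^ k" by simp
    moreover have "integrable M (q k)" using sc unfolding q_def[abs_def] Lp_fun_def by simp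
    ultimately show ?thesis
      by (subst nn_integral_eq_integral) (auto simp: q_def[abs_def] intro!: ennreal_leI)
  qed
  have "(\<integral>\<^sup>+x. (\<Sum>k. ennreal (q k x)) \<partial>M) = (\<Sum>k. \<integral>\<^sup>+x. ennreal (q k x) \<partial>M)"
    by (rule nn_integral_suminf) measurable
  also have "\<dots> \<le> (\<Sum>k. ennreal ((1/2) ^ k))"
    by (intro suminf_le q_int) auto
  also have "\<dots> = ennreal (\<Sum>k. (1/2) ^ k)"
    by (rule suminf_ennreal2) auto
  also have "\<dots> < \<infinity>" by simp
  finally have fin: "(\<integral>\<^sup>+x. (\<Sum>k. ennreal (q k x)) \<partial>M) \<noteq> \<infinity>" by simp
  have "AE x in M. (\<Sum>k. ennreal (q k x)) \<noteq> \<infinity>"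
    by (rule nn_integral_PInf_AE[OF _ fin]) measurable
  then show ?thesis
  proof eventually_elim
    case (elim x)
    have "summable (\<lambda>k. q k x)"
      using elim by (intro summable_suminf_not_top) (auto simp: q_def)
    then have "(\<lambda>k. q k x) \<longlonglongrightarrow> 0" by (rule summable_LIMSEQ_zero)
    then have "eventually (\<lambda>k. q k x < 1) sequentially" by (rule order_tendstoD) simp
    then have "eventually (\<lambda>k. norm \<bar>h k x\<bar> \<le> (1/2) ^ k) sequentially"
    proof eventually_elim
      case (elim k)
      have "\<bar>2 ^ k * h k x\<bar> \<le> 1"
      proof (rule ccontr)
        assume "\<not> \<bar>2 ^ k * h k x\<bar> \<le> 1"
        then have "1 \<le> \<bar>2 ^ k * h k x\<bar> powr p" using p by (intro ge_one_powr_ge_zero) auto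
        then show False using elim by (simp add: q_def)
      qed
      then show ?case by (simp add: abs_mult power_divide field_simps)
    qed
    then show ?case
      by (rule summable_comparison_test_ev) (simp add: summable_geometric)
  qed
qed

text \<open>Riesz--Fischer: a fast Cauchy subsequence converges almost everywhere by telescoping, and Fatou's
  lemma turns the Cauchy estimates into estimates of the distance to the pointwise limit.\<close>

lemma Lp_complete:
  fixes f :: "nat \<Rightarrow> 'a \<Rightarrow> real"
  assumes p: "1 \<le> p" and f: "\<And>n. f n \<in> Lp_fun p M"
    and Cauchy: "\<And>e. e > 0 \<Longrightarrow> \<exists>N. \<forall>m\<ge>N. \<forall>n\<ge>N. Lp_norm p M (\<lambda>x. f m x - f n x) < e"
  obtains g where "g \<in> Lp_fun p M" "(\<lambda>n. Lp_norm p M (\<lambda>x. f n x - g x)) \<longlonglongrightarrow> 0"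
proof -
  have [measurable]: "f n \<in> borel_measurable M" for n using f by (simp add: Lp_fun_def)
  have "\<exists>R. \<forall>k. \<forall>m\<ge>R k. \<forall>n\<ge>R k. Lp_norm p M (\<lambda>x. f m x - f n x) < (1/4) ^ k"
    by (intro choice allI Cauchy) simp
  then obtain R where R: "\<And>k m n. m \<ge> R k \<Longrightarrow> n \<ge> R k \<Longrightarrow> Lp_norm p M (\<lambda>x. f m x - f n x) < (1/4) ^ k"
    by blast
  \<comment> \<open>The sum makes \<open>r k\<close> and \<open>r (Suc k)\<close> at least the threshold \<open>R k\<close>; the summand \<open>k\<close> forces \<open>r k\<close> to infinity.\<close>
  define r where "r k = k + (\<Sum>i\<le>k. R i)" for k
  have r_ge: "k \<le> r k" "R k \<le> r k" "R k \<le> r (Suc k)" for k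
    using member_le_sum[of k "{..k}" R] by (auto simp: r_def)
  define g where "g x = lim (\<lambda>k. f (r k) x)" for x
  have [measurable]: "g \<in> borel_measurable M" unfolding g_def by measurable
  have "AE x in M. summable (\<lambda>k. \<bar>f (r (Suc k)) x - f (r k) x\<bar>)"
    by (rule AE_summable_of_geometric_Lp_norm[OF p])
       (use R r_ge in \<open>auto intro!: Lp_fun_diff[OF p f f] less_imp_le\<close>)
  then have lim: "AE x in M. (\<lambda>k. f (r k) x) \<longlonglongrightarrow> g x"
  proof eventually_elim
    case (elim x)
    then have "summable (\<lambda>k. f (r (Suc k)) x - f (r k) x)" by (rule summable_rabs_cancel)
    then have "convergent (\<lambda>n. \<Sum>k<n. f (r (Suc k)) x - f (r k) x)"
      by (simp add: summable_iff_convergent)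
    then have "convergent (\<lambda>n. f (r n) x - f (r 0) x)" by (simp only: sum_lessThan_telescope[of "\<lambda>k. f (r k) x"])
    then have "convergent (\<lambda>n. f (r n) x)" by (simp add: convergent_diff_const_right_iff)
    then show ?case unfolding g_def by (simp add: convergent_LIMSEQ_iff)
  qed
  have close: "(\<lambda>x. f n x - g x) \<in> Lp_fun p M \<and> Lp_norm p M (\<lambda>x. f n x - g x) \<le> e"
    if e: "e > 0" and N: "\<forall>m\<ge>N. \<forall>n\<ge>N. Lp_norm p M (\<lambda>x. f m x - f n x) < e" and n: "n \<ge> N" for n N e
  proof -
    have "(\<integral>\<^sup>+x. ennreal (\<bar>f n x - g x\<bar> powr p) \<partial>M)
          = (\<integral>\<^sup>+x. liminf (\<lambda>k. ennreal (\<bar>f n x - f (r k) x\<bar> powr p)) \<partial>M)"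
    proof (rule nn_integral_cong_AE, use lim in eventually_elim)
      case (elim x)
      have "(\<lambda>k. ennreal (\<bar>f n x - f (r k) x\<bar> powr p)) \<longlonglongrightarrow> ennreal (\<bar>f n x - g x\<bar> powr p)"
        using p by (intro tendsto_ennrealI tendsto_powr2 tendsto_rabs tendsto_diff tendsto_const elim) auto
      then show ?case by (rule lim_imp_Liminf[OF trivial_limit_sequentially, symmetric])
    qed
    also have "\<dots> \<le> liminf (\<lambda>k. \<integral>\<^sup>+x. ennreal (\<bar>f n x - f (r k) x\<bar> powr p) \<partial>M)"
      by (rule nn_integral_liminf) measurable
    also have "\<dots> \<le> ennreal (e powr p)"
    proof (rule Liminf_le)
      have "(\<integral>\<^sup>+x. ennreal (\<bar>f n x - f (r k) x\<bar> powr p) \<partial>M) \<le> ennreal (e powr p)" if "k \<ge> N" for k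
      proof -
        have "Lp_norm p M (\<lambda>x. f n x - f (r k) x) \<le> e"
          using N n r_ge(1)[of k] that by (auto intro!: less_imp_le)
        then show ?thesis
          using Lp_fun_diff[OF p f f, of n "r k"] e Lp_norm_le_iff[OF p, of e M "\<lambda>x. f n x - f (r k) x"]
          by (subst nn_integral_eq_integral) (auto simp: Lp_fun_def intro!: ennreal_leI)
      qed
      then show "\<forall>\<^sub>F k in sequentially. (\<integral>\<^sup>+x. ennreal (\<bar>f n x - f (r k) x\<bar> powr p) \<partial>M) \<le> ennreal (e powr p)"
        by (rule eventually_sequentiallyI)
    qed simp
    finally have le: "(\<integral>\<^sup>+x. ennreal (\<bar>f n x - g x\<bar> powr p) \<partial>M) \<le> ennreal (e powr p)" .
    have int: "integrable M (\<lambda>x. \<bar>f n x - g x\<bar> powr p)"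
      by (rule integrableI_bounded) (use le in \<open>auto simp: top_unique less_top[symmetric]\<close>)
    moreover have "(\<integral>x. \<bar>f n x - g x\<bar> powr p \<partial>M) \<le> e powr p"
      using le int by (subst (asm) nn_integral_eq_integral) (auto simp: ennreal_le_iff)
    ultimately show ?thesis
      using Lp_norm_le_iff[OF p, of e M "\<lambda>x. f n x - g x"] e by (auto simp: Lp_fun_def)
  qed
  show ?thesis
  proof
    obtain N where "\<forall>m\<ge>N. \<forall>n\<ge>N. Lp_norm p M (\<lambda>x. f m x - f n x) < 1" using Cauchy[of 1] by auto
    then have "(\<lambda>x. f N x - g x) \<in> Lp_fun p M" using close[of 1 N N] by simp
    then show "g \<in> Lp_fun p M" using Lp_fun_diff[OF p f, of "\<lambda>x. f N x - g x" N] by simp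
    show "(\<lambda>n. Lp_norm p M (\<lambda>x. f n x - g x)) \<longlonglongrightarrow> 0"
    proof (rule LIMSEQ_I)
      fix e :: real assume "e > 0"
      then obtain N where "\<forall>m\<ge>N. \<forall>n\<ge>N. Lp_norm p M (\<lambda>x. f m x - f n x) < e / 2"
        using Cauchy[of "e / 2"] by auto
      then have "Lp_norm p M (\<lambda>x. f n x - g x) \<le> e / 2" if "n \<ge> N" for n
        using close[of "e / 2" N n] \<open>e > 0\<close> that by simp
      then have "norm (Lp_norm p M (\<lambda>x. f n x - g x) - 0) < e" if "n \<ge> N" for n
        using \<open>e > 0\<close> that by fastforce
      then show "\<exists>N. \<forall>n\<ge>N. norm (Lp_norm p M (\<lambda>x. f n x - g x) - 0) < e" by blast
    qed
  qed
qed

definition Lp_class :: "real \<Rightarrow> 'a measure \<Rightarrow> ('a \<Rightarrow> real) \<Rightarrow> ('a \<Rightarrow> real) set" where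
  "Lp_class p M u = Lp_rel p M `` {u}"

lemma Lp_class_in_space: "u \<in> Lp_fun p M \<Longrightarrow> Lp_class p M u \<in> Lp_space p M"
  by (simp add: Lp_class_def Lp_space_def quotientI)

lemma mem_Lp_class_iff: "v \<in> Lp_class p M u \<longleftrightarrow> (u, v) \<in> Lp_rel p M"
  by (simp add: Lp_class_def)

lemma Lp_class_rep: "A \<in> Lp_space p M \<Longrightarrow> Lp_class p M (Lp_rep A) = A"
  using Lp_rep_in(1)[of A p M] unfolding Lp_space_def Lp_class_def
  by (metis (no_types) Image_singleton_iff equiv_Lp_rel equiv_class_eq quotientE)

lemma Lp_dist_class:
  assumes p: "1 \<le> p" and u: "u \<in> Lp_fun p M" and v: "v \<in> Lp_fun p M"
  shows "Lp_dist p M (Lp_class p M u) (Lp_class p M v) = Lp_norm p M (\<lambda>x. u x - v x)"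
proof -
  let ?u = "Lp_rep (Lp_class p M u)" and ?v = "Lp_rep (Lp_class p M v)"
  have fu: "(u, ?u) \<in> Lp_rel p M" "(v, ?v) \<in> Lp_rel p M"
    using Lp_rep_in(1)[OF Lp_class_in_space] u v by (simp_all add: mem_Lp_class_iff)
  then have "AE x in M. u x = ?u x" "AE x in M. v x = ?v x" "?u \<in> Lp_fun p M" "?v \<in> Lp_fun p M"
    by (auto simp: Lp_rel_def)
  then show ?thesis
    unfolding Lp_dist_def using u v by (intro Lp_norm_cong_AE Lp_fun_diff[OF p]) auto
qed

lemma mcomplete_Lp:
  assumes p: "1 \<le> p"
  shows "Metric_space.mcomplete (Lp_space p M) (Lp_dist p M)"
proof -
  interpret Metric_space "Lp_space p M" "Lp_dist p M" by (rule Metric_space_Lp[OF p])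
  show ?thesis
    unfolding mcomplete_def
  proof (intro allI impI)
    fix \<sigma> assume \<sigma>: "MCauchy \<sigma>"
    then have X: "\<sigma> n \<in> Lp_space p M" for n by (auto simp: MCauchy_def)
    define f where "f n = Lp_rep (\<sigma> n)" for n
    have f: "f n \<in> Lp_fun p M" for n using Lp_rep_in(2)[OF X] by (simp add: f_def)
    have "\<exists>N. \<forall>m\<ge>N. \<forall>n\<ge>N. Lp_norm p M (\<lambda>x. f m x - f n x) < e" if "e > 0" for e
      using \<sigma> that by (simp add: MCauchy_def Lp_dist_def f_def)
    from Lp_complete[OF p f this] obtain g where g: "g \<in> Lp_fun p M" "(\<lambda>n. Lp_norm p M (\<lambda>x. f n x - g x)) \<longlonglongrightarrow> 0"
      by blast
    have "Lp_dist p M (\<sigma> n) (Lp_class p M g) = Lp_norm p M (\<lambda>x. f n x - g x)" for n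
      using Lp_dist_class[OF p f g(1), of n] Lp_class_rep[OF X, of n] by (simp add: f_def)
    then show "\<exists>x. limitin mtopology \<sigma> x sequentially"
      using g X by (intro exI[of _ "Lp_class p M g"])
        (simp add: limitin_metric_dist_null Lp_class_in_space)
  qed
qed

text \<open>The family \<open>(T u)\<close>, \<open>u \<in> B\<close>, is totally bounded in \<open>L\<^sup>p\<close>: the index set has a finite colouring such
  that indices of one colour give functions at distance less than \<open>e\<close>. Unlike nets, colourings of two
  families are combined by pairing, with no need to choose centres.\<close>

definition Lp_precompact_on ::
  "real \<Rightarrow> 'a measure \<Rightarrow> ('b \<Rightarrow> 'a \<Rightarrow> real) \<Rightarrow> 'b set \<Rightarrow> bool" where
  "Lp_precompact_on p M T B \<longleftrightarrow>
     (\<forall>e>0. \<exists>\<phi> :: 'b \<Rightarrow> nat. finite (\<phi> ` B) \<and>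
        (\<forall>u\<in>B. \<forall>v\<in>B. \<phi> u = \<phi> v \<longrightarrow> Lp_norm p M (\<lambda>x. T u x - T v x) < e))"

text \<open>Any set of colours will do, because only finitely many of them occur.\<close>

lemma Lp_precompact_onI:
  assumes "\<And>e. e > 0 \<Longrightarrow> \<exists>\<phi> :: 'b \<Rightarrow> 'c. finite (\<phi> ` B) \<and>
        (\<forall>u\<in>B. \<forall>v\<in>B. \<phi> u = \<phi> v \<longrightarrow> Lp_norm p M (\<lambda>x. T u x - T v x) < e)"
  shows "Lp_precompact_on p M T B"
  unfolding Lp_precompact_on_def
proof (intro allI impI)
  fix e :: real assume "e > 0"
  then obtain \<phi> :: "'b \<Rightarrow> 'c" where fin: "finite (\<phi> ` B)"
    and \<phi>: "\<forall>u\<in>B. \<forall>v\<in>B. \<phi> u = \<phi> v \<longrightarrow> Lp_norm p M (\<lambda>x. T u x - T v x) < e"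
    using assms by blast
  obtain c :: "'c \<Rightarrow> nat" where c: "inj_on c (\<phi> ` B)"
    using finite_imp_inj_to_nat_seg[OF fin] by blast
  show "\<exists>\<phi> :: 'b \<Rightarrow> nat. finite (\<phi> ` B) \<and>
        (\<forall>u\<in>B. \<forall>v\<in>B. \<phi> u = \<phi> v \<longrightarrow> Lp_norm p M (\<lambda>x. T u x - T v x) < e)"
  proof (intro exI[of _ "c \<circ> \<phi>"] conjI ballI impI)
    show "finite ((c \<circ> \<phi>) ` B)" using fin by (simp flip: image_image)
    show "Lp_norm p M (\<lambda>x. T u x - T v x) < e" if "u \<in> B" "v \<in> B" "(c \<circ> \<phi>) u = (c \<circ> \<phi>) v" for u v
      using \<phi> that inj_onD[OF c, of "\<phi> u" "\<phi> v"] by simp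
  qed
qed

lemma Lp_precompact_on_subset:
  "Lp_precompact_on p M T B \<Longrightarrow> C \<subseteq> B \<Longrightarrow> Lp_precompact_on p M T C"
  unfolding Lp_precompact_on_def by (meson finite_subset image_mono subsetD)

lemma Lp_precompact_on_dominated:
  assumes "Lp_precompact_on p M T B"
    and "\<And>u v. u \<in> B \<Longrightarrow> v \<in> B \<Longrightarrow>
      Lp_norm p M (\<lambda>x. S u x - S v x) \<le> Lp_norm p M (\<lambda>x. T u x - T v x)"
  shows "Lp_precompact_on p M S B"
  using assms unfolding Lp_precompact_on_def by (meson le_less_trans)

lemma Lp_precompact_on_diff:
  fixes R S T :: "'b \<Rightarrow> 'a \<Rightarrow> real"
  assumes p: "1 \<le> p" and S: "Lp_precompact_on p M S B" and T: "Lp_precompact_on p M T B"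
    and SL: "\<And>u. u \<in> B \<Longrightarrow> S u \<in> Lp_fun p M" and TL: "\<And>u. u \<in> B \<Longrightarrow> T u \<in> Lp_fun p M"
    and RL: "\<And>u. u \<in> B \<Longrightarrow> R u \<in> Lp_fun p M"
    and R: "\<And>u. u \<in> B \<Longrightarrow> AE x in M. R u x = S u x - T u x"
  shows "Lp_precompact_on p M R B"
proof (rule Lp_precompact_onI)
  fix e :: real assume "e > 0"
  then have e2: "e / 2 > 0" by simp
  obtain \<phi> :: "'b \<Rightarrow> nat" where fin1: "finite (\<phi> ` B)"
    and \<phi>: "\<forall>u\<in>B. \<forall>v\<in>B. \<phi> u = \<phi> v \<longrightarrow> Lp_norm p M (\<lambda>x. S u x - S v x) < e / 2"
    using S e2 unfolding Lp_precompact_on_def by blast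
  obtain \<psi> :: "'b \<Rightarrow> nat" where fin2: "finite (\<psi> ` B)"
    and \<psi>: "\<forall>u\<in>B. \<forall>v\<in>B. \<psi> u = \<psi> v \<longrightarrow> Lp_norm p M (\<lambda>x. T u x - T v x) < e / 2"
    using T e2 unfolding Lp_precompact_on_def by blast
  have "Lp_norm p M (\<lambda>x. R u x - R v x) < e"
    if uv: "u \<in> B" "v \<in> B" "\<phi> u = \<phi> v" "\<psi> u = \<psi> v" for u v
  proof -
    note in_Lp = SL[OF uv(1)] SL[OF uv(2)] TL[OF uv(1)] TL[OF uv(2)] RL[OF uv(1)] RL[OF uv(2)]
    have "Lp_norm p M (\<lambda>x. R u x - R v x) = Lp_norm p M (\<lambda>x. (S u x - S v x) - (T u x - T v x))"
      using R[OF uv(1)] R[OF uv(2)] in_Lp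
      by (intro Lp_norm_cong_AE Lp_fun_diff[OF p]) auto
    also have "\<dots> \<le> Lp_norm p M (\<lambda>x. S u x - S v x) + Lp_norm p M (\<lambda>x. T u x - T v x)"
      using in_Lp by (intro Lp_norm_diff_le[OF p] Lp_fun_diff[OF p])
    also have "\<dots> < e" using \<phi> \<psi> uv by fastforce
    finally show ?thesis .
  qed
  moreover have "finite ((\<lambda>u. (\<phi> u, \<psi> u)) ` B)"
    by (rule finite_subset[OF _ finite_cartesian_product[OF fin1 fin2]]) auto
  ultimately show "\<exists>\<phi> :: 'b \<Rightarrow> nat \<times> nat. finite (\<phi> ` B) \<and>
        (\<forall>u\<in>B. \<forall>v\<in>B. \<phi> u = \<phi> v \<longrightarrow> Lp_norm p M (\<lambda>x. R u x - R v x) < e)"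
    by (intro exI[of _ "\<lambda>u. (\<phi> u, \<psi> u)"]) auto
qed

text \<open>Compact operators are closed under uniform limits: a colouring for a good approximation also works
  for the limit.\<close>

lemma Lp_precompact_on_limit:
  fixes T :: "'b \<Rightarrow> 'a \<Rightarrow> real"
  assumes p: "1 \<le> p" and TL: "\<And>u. u \<in> B \<Longrightarrow> T u \<in> Lp_fun p M"
    and approx: "\<And>e. e > 0 \<Longrightarrow> \<exists>S. Lp_precompact_on p M S B \<and>
      (\<forall>u\<in>B. S u \<in> Lp_fun p M \<and> Lp_norm p M (\<lambda>x. T u x - S u x) \<le> e)"
  shows "Lp_precompact_on p M T B"
proof (rule Lp_precompact_onI)
  fix e :: real assume "e > 0"
  then obtain S where S: "Lp_precompact_on p M S B"
    and SL: "\<And>u. u \<in> B \<Longrightarrow> S u \<in> Lp_fun p M"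
    and TS: "\<And>u. u \<in> B \<Longrightarrow> Lp_norm p M (\<lambda>x. T u x - S u x) \<le> e / 3"
    using approx[of "e / 3"] by auto
  have "e / 3 > 0" using \<open>e > 0\<close> by simp
  then obtain \<phi> :: "'b \<Rightarrow> nat" where fin: "finite (\<phi> ` B)"
    and \<phi>: "\<forall>u\<in>B. \<forall>v\<in>B. \<phi> u = \<phi> v \<longrightarrow> Lp_norm p M (\<lambda>x. S u x - S v x) < e / 3"
    using S unfolding Lp_precompact_on_def by blast
  have "Lp_norm p M (\<lambda>x. T u x - T v x) < e" if uv: "u \<in> B" "v \<in> B" "\<phi> u = \<phi> v" for u v
  proof -
    note in_Lp = SL[OF uv(1)] SL[OF uv(2)] TL[OF uv(1)] TL[OF uv(2)]
    have "Lp_norm p M (\<lambda>x. T u x - T v x)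
          = Lp_norm p M (\<lambda>x. (T u x - S u x) + ((S u x - S v x) - (T v x - S v x)))" by simp
    also have "\<dots> \<le> Lp_norm p M (\<lambda>x. T u x - S u x) + Lp_norm p M (\<lambda>x. (S u x - S v x) - (T v x - S v x))"
      using in_Lp by (intro Lp_norm_add[OF p] Lp_fun_diff[OF p])
    also have "Lp_norm p M (\<lambda>x. (S u x - S v x) - (T v x - S v x))
      \<le> Lp_norm p M (\<lambda>x. S u x - S v x) + Lp_norm p M (\<lambda>x. T v x - S v x)"
      using in_Lp by (intro Lp_norm_diff_le[OF p] Lp_fun_diff[OF p])
    finally show ?thesis using TS[OF uv(1)] TS[OF uv(2)] \<phi> uv by fastforce
  qed
  then show "\<exists>\<phi> :: 'b \<Rightarrow> nat. finite (\<phi> ` B) \<and>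
        (\<forall>u\<in>B. \<forall>v\<in>B. \<phi> u = \<phi> v \<longrightarrow> Lp_norm p M (\<lambda>x. T u x - T v x) < e)"
    using fin by blast
qed

text \<open>Two of infinitely many indices share a colour.\<close>

lemma Lp_precompact_on_separated:
  fixes T :: "'b \<Rightarrow> 'a \<Rightarrow> real" and w :: "nat \<Rightarrow> 'b"
  assumes T: "Lp_precompact_on p M T B" and w: "\<And>n. w n \<in> B" and e: "e > 0"
    and sep: "\<And>m n. m \<noteq> n \<Longrightarrow> e \<le> Lp_norm p M (\<lambda>x. T (w m) x - T (w n) x)"
  shows False
proof -
  obtain \<phi> :: "'b \<Rightarrow> nat" where fin: "finite (\<phi> ` B)"
    and \<phi>: "\<forall>u\<in>B. \<forall>v\<in>B. \<phi> u = \<phi> v \<longrightarrow> Lp_norm p M (\<lambda>x. T u x - T v x) < e"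
    using T e unfolding Lp_precompact_on_def by blast
  have "inj (\<phi> \<circ> w)"
  proof (rule injI, rule ccontr)
    fix m n assume "(\<phi> \<circ> w) m = (\<phi> \<circ> w) n" "m \<noteq> n"
    then have "Lp_norm p M (\<lambda>x. T (w m) x - T (w n) x) < e" using \<phi> w by simp
    then show False using sep[OF \<open>m \<noteq> n\<close>] by simp
  qed
  moreover have "finite (range (\<phi> \<circ> w))" by (rule finite_subset[OF _ fin]) (use w in auto)
  ultimately show False using range_inj_infinite by blast
qed

text \<open>The passage from classes to functions: \<open>Lp_class\<close> is a distance-preserving parametrisation of \<open>L\<^sup>p\<close> that
  carries \<open>T\<close> to the induced operator, and in a complete space compact closure means total
  boundedness.\<close>

theorem Lp_compact_operator_iff:
  assumes p: "1 \<le> p" and lin: "Lp_linear_operator p M T"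
  shows "Lp_compact_operator p M T \<longleftrightarrow>
    (\<forall>R. Lp_precompact_on p M T {u \<in> Lp_fun p M. Lp_norm p M u \<le> R})"
proof -
  interpret Metric_space "Lp_space p M" "Lp_dist p M" by (rule Metric_space_Lp[OF p])
  define cl where "cl = Lp_class p M"
  define J where "J = Lp_induced p M T"
  define B where "B R = {u \<in> Lp_fun p M. Lp_norm p M u \<le> R}" for R
  have TL: "T u \<in> Lp_fun p M" if "u \<in> Lp_fun p M" for u
    using lin that by (simp add: Lp_linear_operator_def)
  have Jcl: "J (cl u) = cl (T u)" if u: "u \<in> Lp_fun p M" for u
  proof -
    have "Lp_rel p M `` {T v} = cl (T u)" if "v \<in> cl u" for v
    proof -
      have "(u, v) \<in> Lp_rel p M" using that by (simp add: cl_def mem_Lp_class_iff)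
      then have "(T u, T v) \<in> Lp_rel p M"
        using lin TL by (auto simp: Lp_linear_operator_def Lp_rel_def)
      then show ?thesis unfolding cl_def Lp_class_def by (metis equiv_class_eq equiv_Lp_rel)
    qed
    moreover have "u \<in> cl u" using u by (simp add: cl_def mem_Lp_class_iff Lp_rel_def)
    ultimately show ?thesis unfolding J_def Lp_induced_def by blast
  qed
  have clX: "cl u \<in> Lp_space p M" if "u \<in> Lp_fun p M" for u
    using Lp_class_in_space that by (simp add: cl_def)
  have dcl: "Lp_dist p M (cl u) (cl v) = Lp_norm p M (\<lambda>x. u x - v x)"
    if "u \<in> Lp_fun p M" "v \<in> Lp_fun p M" for u v
    using Lp_dist_class[OF p that] by (simp add: cl_def)
  have rep: "cl (Lp_rep A) = A" "Lp_rep A \<in> Lp_fun p M" if "A \<in> Lp_space p M" for A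
    using Lp_class_rep Lp_rep_in(2) that by (auto simp: cl_def)
  have zero: "(\<lambda>x. 0) \<in> Lp_fun p M" by (simp add: Lp_fun_def)
  have bounded_iff: "mbounded (cl ` U) \<longleftrightarrow> (\<exists>R. U \<subseteq> B R)" if U: "U \<subseteq> Lp_fun p M" for U
  proof
    assume "mbounded (cl ` U)"
    then obtain A r where A: "cl ` U \<subseteq> mcball A r" unfolding mbounded_def by blast
    show "\<exists>R. U \<subseteq> B R"
    proof (cases "U = {}")
      case False
      then have AX: "A \<in> Lp_space p M" using A by auto
      have "Lp_norm p M u \<le> r + Lp_norm p M (Lp_rep A)" if "u \<in> U" for u
      proof -
        have u: "u \<in> Lp_fun p M" using that U by blast
        have "Lp_dist p M A (cl u) \<le> r" using A that by auto
        then have "Lp_norm p M (\<lambda>x. Lp_rep A x - u x) \<le> r"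
          using dcl[OF rep(2)[OF AX] u] rep(1)[OF AX] by simp
        moreover have "Lp_norm p M u \<le> Lp_norm p M (\<lambda>x. u x - Lp_rep A x) + Lp_norm p M (Lp_rep A)"
          using Lp_norm_add[OF p Lp_fun_diff[OF p u rep(2)[OF AX]] rep(2)[OF AX]] by simp
        ultimately show ?thesis using Lp_norm_minus_commute[of p M u "Lp_rep A"] by simp
      qed
      then show ?thesis using U by (auto simp: B_def)
    qed (auto simp: B_def)
  next
    assume "\<exists>R. U \<subseteq> B R"
    then obtain R where R: "U \<subseteq> B R" ..
    have "cl ` U \<subseteq> mcball (cl (\<lambda>x. 0)) R"
    proof (clarify)
      fix u assume "u \<in> U"
      then have "u \<in> Lp_fun p M" "Lp_norm p M u \<le> R" using R by (auto simp: B_def)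
      then show "cl u \<in> mcball (cl (\<lambda>x. 0)) R"
        using dcl[OF zero] clX zero by (simp add: Lp_norm_def)
    qed
    then show "mbounded (cl ` U)" unfolding mbounded_def by blast
  qed
  have tb_iff: "mtotally_bounded (J ` cl ` U) \<longleftrightarrow> Lp_precompact_on p M T U" if U: "U \<subseteq> Lp_fun p M" for U
  proof
    assume tb: "mtotally_bounded (J ` cl ` U)"
    show "Lp_precompact_on p M T U"
    proof (rule Lp_precompact_onI)
      fix e :: real assume "e > 0"
      then obtain K where K: "finite K" "J ` cl ` U \<subseteq> (\<Union>x\<in>K. mball x (e / 2))"
        using tb unfolding mtotally_bounded_def by (meson half_gt_zero)
      have "\<exists>k\<in>K. J (cl u) \<in> mball k (e / 2)" if "u \<in> U" for u using K(2) that by blast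
      then obtain \<phi> where \<phi>: "\<And>u. u \<in> U \<Longrightarrow> \<phi> u \<in> K \<and> J (cl u) \<in> mball (\<phi> u) (e / 2)" by metis
      have "Lp_norm p M (\<lambda>x. T u x - T v x) < e" if uv: "u \<in> U" "v \<in> U" "\<phi> u = \<phi> v" for u v
      proof -
        have L: "u \<in> Lp_fun p M" "v \<in> Lp_fun p M" using uv U by auto
        have "cl (T u) \<in> mball (\<phi> u) (e / 2)" "cl (T v) \<in> mball (\<phi> u) (e / 2)"
          using \<phi>[OF uv(1)] \<phi>[OF uv(2)] uv(3) Jcl L by auto
        then have "Lp_dist p M (cl (T u)) (cl (T v)) < e"
          using triangle'[of "cl (T u)" "\<phi> u" "cl (T v)"] by (auto simp: commute)
        then show ?thesis using dcl TL L by simp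
      qed
      moreover have "finite (\<phi> ` U)" by (rule finite_subset[OF _ K(1)]) (use \<phi> in auto)
      ultimately show "\<exists>\<phi> :: ('a \<Rightarrow> real) \<Rightarrow> ('a \<Rightarrow> real) set. finite (\<phi> ` U) \<and>
        (\<forall>u\<in>U. \<forall>v\<in>U. \<phi> u = \<phi> v \<longrightarrow> Lp_norm p M (\<lambda>x. T u x - T v x) < e)"
        by blast
    qed
  next
    assume pc: "Lp_precompact_on p M T U"
    show "mtotally_bounded (J ` cl ` U)"
      unfolding mtotally_bounded_def
    proof (intro allI impI)
      fix e :: real assume "e > 0"
      then obtain \<phi> :: "('a \<Rightarrow> real) \<Rightarrow> nat" where fin: "finite (\<phi> ` U)"
        and \<phi>: "\<forall>u\<in>U. \<forall>v\<in>U. \<phi> u = \<phi> v \<longrightarrow> Lp_norm p M (\<lambda>x. T u x - T v x) < e"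
        using pc unfolding Lp_precompact_on_def by blast
      define w where "w = inv_into U \<phi>"
      have w: "w (\<phi> u) \<in> U" "\<phi> (w (\<phi> u)) = \<phi> u" if "u \<in> U" for u
        using that by (auto simp: w_def inv_into_into f_inv_into_f)
      have "J (cl u) \<in> mball (J (cl (w (\<phi> u)))) e" if "u \<in> U" for u
        using \<phi> w[OF that] that U by (auto simp: Jcl dcl TL clX subset_iff)
      then show "\<exists>K. finite K \<and> K \<subseteq> J ` cl ` U \<and> J ` cl ` U \<subseteq> (\<Union>x\<in>K. mball x e)"
        using fin w(1) by (intro exI[of _ "(\<lambda>c. J (cl (w c))) ` \<phi> ` U"]) auto
    qed
  qed
  have "Lp_compact_operator p M T \<longleftrightarrow>
     (\<forall>S\<subseteq>Lp_space p M. mbounded S \<longrightarrow> compactin mtopology (mtopology closure_of (J ` S)))"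
    by (simp add: Lp_compact_operator_def J_def Let_def)
  also have "\<dots> \<longleftrightarrow> (\<forall>S\<subseteq>Lp_space p M. mbounded S \<longrightarrow> mtotally_bounded (J ` S))"
  proof -
    have "J ` S \<subseteq> Lp_space p M" if "S \<subseteq> Lp_space p M" for S
    proof
      fix A assume "A \<in> J ` S"
      then obtain C where C: "C \<in> S" "A = J C" by blast
      then have "C \<in> Lp_space p M" using that by blast
      then have "A = cl (T (Lp_rep C))" "Lp_rep C \<in> Lp_fun p M" using Jcl[OF rep(2)] rep C(2) by simp_all
      then show "A \<in> Lp_space p M" using clX[OF TL] by simp
    qed
    then have "compactin mtopology (mtopology closure_of (J ` S)) \<longleftrightarrow> mtotally_bounded (J ` S)"
      if "S \<subseteq> Lp_space p M" for S
      using mtotally_bounded_eq_compact_closure_of[OF mcomplete_Lp[OF p], of "J ` S"] that by simp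
    then show ?thesis by (simp cong: imp_cong)
  qed
  also have "\<dots> \<longleftrightarrow> (\<forall>U\<subseteq>Lp_fun p M. mbounded (cl ` U) \<longrightarrow> mtotally_bounded (J ` cl ` U))"
  proof (intro iffI allI impI)
    fix U assume H: "\<forall>S\<subseteq>Lp_space p M. mbounded S \<longrightarrow> mtotally_bounded (J ` S)"
      and U: "U \<subseteq> Lp_fun p M" "mbounded (cl ` U)"
    have "cl ` U \<subseteq> Lp_space p M" using U(1) clX by blast
    then show "mtotally_bounded (J ` cl ` U)" using H U(2) by simp
  next
    fix S assume H: "\<forall>U\<subseteq>Lp_fun p M. mbounded (cl ` U) \<longrightarrow> mtotally_bounded (J ` cl ` U)"
      and S: "S \<subseteq> Lp_space p M" "mbounded S"
    have "Lp_rep ` S \<subseteq> Lp_fun p M" using S(1) rep(2) by blast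
    moreover have "(cl \<circ> Lp_rep) ` S = id ` S" using S(1) rep(1) by (intro image_cong) auto
    then have "cl ` Lp_rep ` S = S" by (simp add: image_comp)
    ultimately show "mtotally_bounded (J ` S)" using H S(2) by metis
  qed
  also have "\<dots> \<longleftrightarrow> (\<forall>U\<subseteq>Lp_fun p M. (\<exists>R. U \<subseteq> B R) \<longrightarrow> Lp_precompact_on p M T U)"
    using bounded_iff tb_iff by simp
  also have "\<dots> \<longleftrightarrow> (\<forall>R. Lp_precompact_on p M T (B R))"
  proof (intro iffI allI impI)
    fix R assume "\<forall>U\<subseteq>Lp_fun p M. (\<exists>R. U \<subseteq> B R) \<longrightarrow> Lp_precompact_on p M T U"
    moreover have "B R \<subseteq> Lp_fun p M" by (auto simp: B_def)
    ultimately show "Lp_precompact_on p M T (B R)" by blast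
  next
    fix U assume "\<forall>R. Lp_precompact_on p M T (B R)" "\<exists>R. U \<subseteq> B R"
    then show "Lp_precompact_on p M T U" using Lp_precompact_on_subset by blast
  qed
  finally show ?thesis by (simp add: B_def)
qed

section \<open>Young's inequality for correlations\<close>

text \<open>The graph of \<open>t \<mapsto> t powr p\<close> lies above its tangent at \<open>s\<close>.\<close>

lemma powr_tangent_le:
  fixes s t p :: real
  assumes p: "1 \<le> p" and s: "0 < s" and t: "0 \<le> t"
  shows "s powr p + p * s powr (p - 1) * (t - s) \<le> t powr p"
proof (cases "t = 0")
  case True
  have "s powr p = s powr (p - 1) * s" using s by (simp add: powr_diff)
  then have "s powr p + p * s powr (p - 1) * (t - s) = (1 - p) * s powr p"
    using True by (simp add: algebra_simps)
  then show ?thesis using True p by (simp add: mult_nonpos_nonneg)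
next
  case False
  have "t powr p - s powr p \<ge> (p * s powr (p - 1)) * (t - s)"
  proof (rule convex_on_imp_above_tangent[OF powr_convex[OF p]])
    show "((\<lambda>x. x powr p) has_real_derivative p * s powr (p - 1)) (at s within {0<..})"
      using s by (auto intro!: derivative_eq_intros)
  qed (use s t False in \<open>auto simp: interior_open\<close>)
  then show ?thesis by simp
qed

text \<open>Jensen's inequality for a weight \<open>w\<close> of arbitrary mass. Integrating the tangent inequality
  at the weighted mean \<open>s\<close> of \<open>\<bar>f\<bar>\<close> against \<open>w\<close> makes the linear term vanish.\<close>

lemma weighted_Jensen_powr:
  fixes f w :: "'a \<Rightarrow> real"
  assumes p: "1 \<le> p" and [measurable]: "f \<in> borel_measurable M"
    and w: "integrable M w" "\<And>x. 0 \<le> w x"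
    and fw: "integrable M (\<lambda>x. \<bar>f x\<bar> powr p * w x)"
  shows "integrable M (\<lambda>x. f x * w x)"
    and "\<bar>\<integral>x. f x * w x \<partial>M\<bar> powr p \<le> (\<integral>x. w x \<partial>M) powr (p - 1) * (\<integral>x. \<bar>f x\<bar> powr p * w x \<partial>M)"
proof -
  have [measurable]: "w \<in> borel_measurable M" using w(1) by simp
  have "integrable M (\<lambda>x. w x + \<bar>f x\<bar> powr p * w x)" using w fw by simp
  then show int: "integrable M (\<lambda>x. f x * w x)"
  proof (rule Bochner_Integration.integrable_bound)
    have "\<bar>f x\<bar> \<le> 1 + \<bar>f x\<bar> powr p" for x
    proof (cases "\<bar>f x\<bar> \<le> 1")
      case False
      then have "\<bar>f x\<bar> powr 1 \<le> \<bar>f x\<bar> powr p" using p by (intro powr_mono) auto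
      then show ?thesis by simp
    qed (simp add: add_increasing2)
    then have "\<bar>f x\<bar> * w x \<le> (1 + \<bar>f x\<bar> powr p) * w x" for x
      using w(2) by (intro mult_right_mono)
    then show "AE x in M. norm (f x * w x) \<le> norm (w x + \<bar>f x\<bar> powr p * w x)"
      using w(2) by (intro AE_I2) (auto simp: abs_mult algebra_simps)
  qed measurable
  then have int': "integrable M (\<lambda>x. \<bar>f x\<bar> * w x)"
    using integrable_abs[OF int] w(2) by (simp add: abs_mult)
  define W A where "W = (\<integral>x. w x \<partial>M)" and "A = (\<integral>x. \<bar>f x\<bar> * w x \<partial>M)"
  have WA: "0 \<le> W" "0 \<le> A" using w(2) by (auto simp: W_def A_def)
  have "\<bar>\<integral>x. f x * w x \<partial>M\<bar> \<le> A"
    unfolding A_def using integral_abs_bound[of M "\<lambda>x. f x * w x"] w(2) by (simp add: abs_mult)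
  then have "\<bar>\<integral>x. f x * w x \<partial>M\<bar> powr p \<le> A powr p"
    using p by (intro powr_mono2) auto
  also have "A powr p \<le> W powr (p - 1) * (\<integral>x. \<bar>f x\<bar> powr p * w x \<partial>M)"
  proof (cases "A = 0")
    case True
    then show ?thesis using w(2) by simp
  next
    case False
    have "W \<noteq> 0"
    proof
      assume "W = 0"
      then have "AE x in M. w x = 0"
        using integral_nonneg_eq_0_iff_AE[OF w(1)] w(2) by (simp add: W_def)
      then have "AE x in M. \<bar>f x\<bar> * w x = 0" by eventually_elim simp
      then have "A = 0" unfolding A_def by (rule integral_eq_zero_AE)
      then show False using False by simp
    qed
    then have pos: "0 < W" "0 < A" using WA False by auto
    define s where "s = A / W"
    have s: "0 < s" using pos by (simp add: s_def)
    have "(\<integral>x. (s powr p * w x + p * s powr (p - 1) * (\<bar>f x\<bar> * w x - s * w x)) \<partial>M)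
          \<le> (\<integral>x. \<bar>f x\<bar> powr p * w x \<partial>M)"
    proof (rule integral_mono)
      fix x
      show "s powr p * w x + p * s powr (p - 1) * (\<bar>f x\<bar> * w x - s * w x) \<le> \<bar>f x\<bar> powr p * w x"
        using mult_right_mono[OF powr_tangent_le[OF p s, of "\<bar>f x\<bar>"] w(2)[of x]] by (simp add: algebra_simps)
    qed (use w fw int' in auto)
    also have "(\<integral>x. (s powr p * w x + p * s powr (p - 1) * (\<bar>f x\<bar> * w x - s * w x)) \<partial>M)
          = s powr p * W + p * s powr (p - 1) * (A - s * W)"
      using w int' by (simp add: W_def A_def)
    also have "\<dots> = s powr p * W" using pos by (simp add: s_def)
    finally have le: "s powr p * W \<le> (\<integral>x. \<bar>f x\<bar> powr p * w x \<partial>M)" .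
    have "A powr p = W powr (p - 1) * (s powr p * W)"
      using pos by (simp add: s_def powr_divide powr_diff)
    also have "\<dots> \<le> W powr (p - 1) * (\<integral>x. \<bar>f x\<bar> powr p * w x \<partial>M)"
      using le by (intro mult_left_mono) auto
    finally show ?thesis .
  qed
  finally show "\<bar>\<integral>x. f x * w x \<partial>M\<bar> powr p \<le> (\<integral>x. w x \<partial>M) powr (p - 1) * (\<integral>x. \<bar>f x\<bar> powr p * w x \<partial>M)"
    by (simp add: W_def)
qed

lemma lborel_translation:
  fixes f :: "'a::euclidean_space \<Rightarrow> real"
  assumes [measurable]: "f \<in> borel_measurable borel"
  shows "integrable lborel (\<lambda>x. f (a + x)) \<longleftrightarrow> integrable lborel f"
    and "(\<integral>x. f (a + x) \<partial>lborel) = (\<integral>x. f x \<partial>lborel)"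
proof -
  have m: "(+) a \<in> measurable lborel borel" by simp
  show "integrable lborel (\<lambda>x. f (a + x)) \<longleftrightarrow> integrable lborel f"
    using integrable_distr_eq[OF m, of f] by (simp add: lborel_distr_plus)
  show "(\<integral>x. f (a + x) \<partial>lborel) = (\<integral>x. f x \<partial>lborel)"
    using integral_distr[OF m, of f] by (simp add: lborel_distr_plus)
qed

text \<open>Stated for \<open>lebesgue\<close>, where arbitrary subsets of null sets are null and \<open>P\<close> can be any property.\<close>

lemma AE_lebesgue_translation:
  fixes a :: "'a::euclidean_space"
  assumes "AE x in lebesgue. P x"
  shows "AE x in lebesgue. P (x - a)"
proof -
  obtain N where N: "negligible N" "{x. \<not> P x} \<subseteq> N"
    using assms by (auto simp: eventually_ae_filter_negligible)
  then have "{x. \<not> P (x - a)} \<subseteq> (+) a ` N" by (auto simp: image_iff intro!: bexI[of _ "_ - a"])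
  then show ?thesis
    using negligible_translation[OF N(1)] by (auto simp: eventually_ae_filter_negligible)
qed

text \<open>Young's inequality. Jensen bounds \<open>\<bar>c x\<bar> powr p\<close> by the integral over \<open>z\<close> of
  \<open>\<bar>v (x + z)\<bar> powr p * \<bar>h z\<bar>\<close>, and Fubini together with translation invariance computes the integral of
  that in \<open>x\<close>. The functions are Borel so that the integrand is measurable for the
  product measure.\<close>

lemma Young_correlation_borel:
  fixes v h :: "'a::euclidean_space \<Rightarrow> real"
  assumes p: "1 \<le> p" and [measurable]: "v \<in> borel_measurable borel" "h \<in> borel_measurable borel"
    and v: "integrable lborel (\<lambda>x. \<bar>v x\<bar> powr p)" and h: "integrable lborel h"
  defines "c \<equiv> \<lambda>x. \<integral>y. v y * h (y - x) \<partial>lborel"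
  shows "AE x in lborel. integrable lborel (\<lambda>y. v y * h (y - x))"
    and "c \<in> borel_measurable borel"
    and "integrable lborel (\<lambda>x. \<bar>c x\<bar> powr p)"
    and "(\<integral>x. \<bar>c x\<bar> powr p \<partial>lborel) \<le> (\<integral>x. \<bar>h x\<bar> \<partial>lborel) powr p * (\<integral>x. \<bar>v x\<bar> powr p \<partial>lborel)"
proof -
  define W V where "W = (\<integral>x. \<bar>h x\<bar> \<partial>lborel)" and "V = (\<integral>x. \<bar>v x\<bar> powr p \<partial>lborel)"
  define F where "F z x = \<bar>v (x + z)\<bar> powr p * \<bar>h z\<bar>" for z x
  define G where "G x = (\<integral>z. F z x \<partial>lborel)" for x
  have trans_v: "integrable lborel (\<lambda>x. \<bar>v (x + z)\<bar> powr p)" "(\<integral>x. \<bar>v (x + z)\<bar> powr p \<partial>lborel) = V" for z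
    using lborel_translation[of "\<lambda>x. \<bar>v x\<bar> powr p" z] v by (simp_all add: V_def add.commute)
  have Fint: "(\<integral>x. F z x \<partial>lborel) = V * \<bar>h z\<bar>" for z by (simp add: F_def trans_v)
  have F_int: "integrable (lborel \<Otimes>\<^sub>M lborel) (case_prod F)"
  proof (rule lborel_pair.Fubini_integrable)
    show "case_prod F \<in> borel_measurable (lborel \<Otimes>\<^sub>M lborel)" unfolding F_def by measurable
    have "(\<integral>x. norm (case_prod F (z, x)) \<partial>lborel) = V * \<bar>h z\<bar>" for z
      using Fint[of z] by (simp add: F_def)
    then show "integrable lborel (\<lambda>z. \<integral>x. norm (case_prod F (z, x)) \<partial>lborel)" using h by simp
    show "AE z in lborel. integrable lborel (\<lambda>x. case_prod F (z, x))"
      using trans_v by (simp add: F_def)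
  qed
  have G_int: "integrable lborel G" unfolding G_def by (rule lborel_pair.integrable_snd[OF F_int])
  have "(\<integral>x. G x \<partial>lborel) = (\<integral>z. (\<integral>x. F z x \<partial>lborel) \<partial>lborel)"
    unfolding G_def by (rule lborel_pair.Fubini_integral[OF F_int])
  also have "\<dots> = V * W" using h by (simp add: Fint W_def)
  finally have G_val: "(\<integral>x. G x \<partial>lborel) = V * W" .
  have shift: "integrable lborel (\<lambda>y. v y * h (y - x)) \<longleftrightarrow> integrable lborel (\<lambda>z. v (x + z) * h z)"
    "c x = (\<integral>z. v (x + z) * h z \<partial>lborel)" for x
    using lborel_translation[of "\<lambda>y. v y * h (y - x)" x] by (simp_all add: c_def)
  have key: "integrable lborel (\<lambda>y. v y * h (y - x)) \<and> \<bar>c x\<bar> powr p \<le> W powr (p - 1) * G x"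
    if F: "integrable lborel (\<lambda>z. F z x)" for x
  proof -
    \<comment> \<open>Moving the sign of \<open>h\<close> into the function leaves the nonnegative weight \<open>\<bar>h\<bar>\<close>.\<close>
    define f where "f z = v (x + z) * sgn (h z)" for z
    have [measurable]: "f \<in> borel_measurable lborel" unfolding f_def by measurable
    have eq: "f z * \<bar>h z\<bar> = v (x + z) * h z" "\<bar>f z\<bar> powr p * \<bar>h z\<bar> = F z x" for z
      by (auto simp: f_def F_def abs_mult sgn_real_def add.commute)
    have "integrable lborel (\<lambda>z. f z * \<bar>h z\<bar>)"
      "\<bar>\<integral>z. f z * \<bar>h z\<bar> \<partial>lborel\<bar> powr p
        \<le> (\<integral>z. \<bar>h z\<bar> \<partial>lborel) powr (p - 1) * (\<integral>z. \<bar>f z\<bar> powr p * \<bar>h z\<bar> \<partial>lborel)"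
      by (rule weighted_Jensen_powr[OF p]; use h F in \<open>simp add: eq\<close>)+
    then show ?thesis by (simp add: eq shift W_def G_def)
  qed
  have AE_F: "AE x in lborel. integrable lborel (\<lambda>z. F z x)" by (rule lborel_pair.AE_integrable_snd[OF F_int])
  then show "AE x in lborel. integrable lborel (\<lambda>y. v y * h (y - x))"
    by eventually_elim (use key in blast)
  have AE_le: "AE x in lborel. \<bar>c x\<bar> powr p \<le> W powr (p - 1) * G x"
    using AE_F by eventually_elim (use key in blast)
  show c_meas [measurable]: "c \<in> borel_measurable borel"
  proof -
    have "(\<lambda>x. \<integral>y. v y * h (y - x) \<partial>lborel) \<in> borel_measurable lborel"
      by (rule lborel.borel_measurable_lebesgue_integral) measurable
    then show ?thesis by (simp add: c_def)
  qed
  have G_nn: "0 \<le> G x" for x by (simp add: G_def F_def)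
  have WG: "integrable lborel (\<lambda>x. W powr (p - 1) * G x)" using G_int by simp
  show ic: "integrable lborel (\<lambda>x. \<bar>c x\<bar> powr p)"
    by (rule Bochner_Integration.integrable_bound[OF WG]) (use AE_le G_nn in \<open>auto simp: abs_mult\<close>)
  have "(\<integral>x. \<bar>c x\<bar> powr p \<partial>lborel) \<le> (\<integral>x. W powr (p - 1) * G x \<partial>lborel)"
    by (rule integral_mono_AE[OF ic WG AE_le])
  also have "\<dots> = W powr (p - 1) * W * V" by (simp add: G_val)
  also have "W powr (p - 1) * W = W powr p"
    using p by (cases "W = 0") (auto simp: powr_diff W_def)
  finally show "(\<integral>x. \<bar>c x\<bar> powr p \<partial>lborel) \<le> (\<integral>x. \<bar>h x\<bar> \<partial>lborel) powr p * (\<integral>x. \<bar>v x\<bar> powr p \<partial>lborel)"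
    by (simp add: W_def V_def)
qed

text \<open>The kernel is evaluated at \<open>y - x\<close> as in the nonlocal derivative; this is the convolution with the
  reflected kernel, restricted to \<open>E\<close>.\<close>

definition correlation :: "'a::euclidean_space set \<Rightarrow> ('a \<Rightarrow> real) \<Rightarrow> ('a \<Rightarrow> real) \<Rightarrow> 'a \<Rightarrow> real" where
  "correlation E k u x = (\<integral>y. indicator E y * u y * k (y - x) \<partial>lebesgue)"

lemma Lp_fun_lebesgue_on_iff:
  assumes "E \<in> sets lebesgue"
  shows "u \<in> Lp_fun p (lebesgue_on E) \<longleftrightarrow>
    (\<lambda>x. indicator E x * u x) \<in> borel_measurable lebesgue \<and>
    integrable lebesgue (\<lambda>x. \<bar>indicator E x * u x\<bar> powr p)"
proof -
  have "\<bar>indicator E x * u x\<bar> powr p = indicator E x *\<^sub>R \<bar>u x\<bar> powr p" for x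
    by (simp add: indicator_def)
  then show ?thesis
    using assms
    by (simp add: Lp_fun_def integrable_restrict_space borel_measurable_restrict_space_iff)
qed

lemma Lp_norm_lebesgue_on:
  assumes "E \<in> sets lebesgue"
  shows "Lp_norm p (lebesgue_on E) u = (\<integral>x. \<bar>indicator E x * u x\<bar> powr p \<partial>lebesgue) powr (1 / p)"
proof -
  have "\<bar>indicator E x * u x\<bar> powr p = indicator E x *\<^sub>R \<bar>u x\<bar> powr p" for x
    by (simp add: indicator_def)
  then show ?thesis using assms by (simp add: Lp_norm_def integral_restrict_space)
qed

lemma
  fixes k u :: "'a::euclidean_space \<Rightarrow> real"
  assumes p: "1 \<le> p" and E: "E \<in> sets lebesgue" and u: "u \<in> Lp_fun p (lebesgue_on E)"
    and k: "integrable lebesgue k"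
  shows correlation_integrand_measurable: "(\<lambda>y. indicator E y * u y * k (y - x)) \<in> borel_measurable lebesgue"
    and AE_integrable_correlation: "AE x in lebesgue. integrable lebesgue (\<lambda>y. indicator E y * u y * k (y - x))"
    and borel_measurable_correlation: "correlation E k u \<in> borel_measurable lebesgue"
    and correlation_in_Lp: "correlation E k u \<in> Lp_fun p (lebesgue_on E)"
    and Young_correlation: "Lp_norm p (lebesgue_on E) (correlation E k u)
       \<le> (\<integral>z. \<bar>k z\<bar> \<partial>lebesgue) * Lp_norm p (lebesgue_on E) u"
proof -
  let ?Eu = "\<lambda>y. indicator E y * u y"
  have Eu: "?Eu \<in> borel_measurable lebesgue" "integrable lebesgue (\<lambda>y. \<bar>?Eu y\<bar> powr p)"
    using u by (simp_all add: Lp_fun_lebesgue_on_iff[OF E])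
  \<comment> \<open>Changing both factors on null sets changes the integrand, for each fixed \<open>x\<close>, only on a null set.\<close>
  obtain v where v [measurable]: "v \<in> borel_measurable borel" and Euv: "AE y in lebesgue. ?Eu y = v y"
    using completion_ex_borel_measurable_real[OF Eu(1)] by (auto simp: AE_completion)
  obtain h where h [measurable]: "h \<in> borel_measurable borel" and kh: "AE y in lebesgue. k y = h y"
    using completion_ex_borel_measurable_real[OF borel_measurable_integrable[OF k]] by (auto simp: AE_completion)
  have k_meas: "k \<in> borel_measurable lebesgue" using k by simp
  have cm: "w \<in> borel_measurable borel \<Longrightarrow> w \<in> borel_measurable lebesgue" for w :: "'a \<Rightarrow> real"
    by (rule measurable_completion) simp
  have comp: "integrable lebesgue w \<longleftrightarrow> integrable lborel w" "integral\<^sup>L lebesgue w = integral\<^sup>L lborel w"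
    if "w \<in> borel_measurable borel" for w :: "'a \<Rightarrow> real"
    using that by (auto simp: integrable_completion integral_completion)
  have vp: "AE y in lebesgue. \<bar>?Eu y\<bar> powr p = \<bar>v y\<bar> powr p"
    using Euv by eventually_elim simp
  have "integrable lebesgue (\<lambda>y. \<bar>v y\<bar> powr p)"
    using Eu(2) by (subst integrable_cong_AE[where g = "\<lambda>y. \<bar>?Eu y\<bar> powr p"])
      (use vp Eu(1) in \<open>auto intro: cm\<close>)
  then have vi: "integrable lborel (\<lambda>y. \<bar>v y\<bar> powr p)" by (simp add: comp)
  have v_norm: "(\<integral>y. \<bar>?Eu y\<bar> powr p \<partial>lebesgue) = (\<integral>y. \<bar>v y\<bar> powr p \<partial>lborel)"
    using integral_cong_AE[OF _ _ vp] Eu(1) by (simp add: comp[symmetric] cm)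
  have "integrable lebesgue h"
    using k by (subst integrable_cong_AE[where g = k]) (use kh in \<open>auto intro: cm\<close>)
  then have hi: "integrable lborel h" by (simp add: comp)
  have "AE y in lebesgue. \<bar>k y\<bar> = \<bar>h y\<bar>" using kh by eventually_elim simp
  then have h_norm: "(\<integral>y. \<bar>k y\<bar> \<partial>lebesgue) = (\<integral>y. \<bar>h y\<bar> \<partial>lborel)"
    using integral_cong_AE[of "\<lambda>y. \<bar>k y\<bar>" lebesgue "\<lambda>y. \<bar>h y\<bar>"] k_meas by (simp add: comp[symmetric] cm)
  have prod: "AE y in lebesgue. v y * h (y - x) = ?Eu y * k (y - x)" for x
    using Euv AE_lebesgue_translation[OF kh, of x] by eventually_elim simp
  have vh_meas: "(\<lambda>y. v y * h (y - x)) \<in> borel_measurable lebesgue" for x by (rule cm) measurable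
  have meas: "(\<lambda>y. ?Eu y * k (y - x)) \<in> borel_measurable lebesgue" for x
    by (rule borel_measurable_AE[OF vh_meas prod])
  then show "(\<lambda>y. ?Eu y * k (y - x)) \<in> borel_measurable lebesgue" .
  have int_iff: "integrable lebesgue (\<lambda>y. ?Eu y * k (y - x)) \<longleftrightarrow> integrable lborel (\<lambda>y. v y * h (y - x))" for x
    using integrable_cong_AE[OF vh_meas meas prod] by (simp add: comp)
  have corr_eq: "correlation E k u = (\<lambda>x. \<integral>y. v y * h (y - x) \<partial>lborel)"
    using integral_cong_AE[OF vh_meas meas prod] by (simp add: comp correlation_def fun_eq_iff)
  note Y = Young_correlation_borel[OF p v h vi hi]
  show "AE x in lebesgue. integrable lebesgue (\<lambda>y. indicator E y * u y * k (y - x))"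
    using AE_completion[OF Y(1)] by (simp add: int_iff)
  show cmeas: "correlation E k u \<in> borel_measurable lebesgue" unfolding corr_eq by (rule cm[OF Y(2)])
  have ci: "integrable lebesgue (\<lambda>x. \<bar>correlation E k u x\<bar> powr p)"
    using Y(2,3) by (subst comp) (auto simp: corr_eq)
  have le: "\<bar>indicator E x * correlation E k u x\<bar> powr p \<le> \<bar>correlation E k u x\<bar> powr p" for x
    by (simp add: indicator_def)
  have Ec: "(\<lambda>x. indicator E x * correlation E k u x) \<in> borel_measurable lebesgue"
    using cmeas E by auto
  have Eci: "integrable lebesgue (\<lambda>x. \<bar>indicator E x * correlation E k u x\<bar> powr p)"
    by (rule Bochner_Integration.integrable_bound[OF ci]) (use le Ec in auto)
  show "correlation E k u \<in> Lp_fun p (lebesgue_on E)"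
    using Ec Eci by (simp add: Lp_fun_lebesgue_on_iff[OF E])
  have "(\<integral>x. \<bar>indicator E x * correlation E k u x\<bar> powr p \<partial>lebesgue)
      \<le> (\<integral>x. \<bar>correlation E k u x\<bar> powr p \<partial>lebesgue)"
    by (rule integral_mono[OF Eci ci le])
  also have "\<dots> = (\<integral>x. \<bar>correlation E k u x\<bar> powr p \<partial>lborel)"
    using Y(2) by (subst comp) (auto simp: corr_eq)
  also have "\<dots> \<le> (\<integral>y. \<bar>k y\<bar> \<partial>lebesgue) powr p * (\<integral>y. \<bar>?Eu y\<bar> powr p \<partial>lebesgue)"
    using Y(4) by (simp add: h_norm v_norm corr_eq)
  finally have "Lp_norm p (lebesgue_on E) (correlation E k u)
    \<le> ((\<integral>y. \<bar>k y\<bar> \<partial>lebesgue) powr p * (\<integral>y. \<bar>?Eu y\<bar> powr p \<partial>lebesgue)) powr (1 / p)"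
    unfolding Lp_norm_lebesgue_on[OF E] using p by (intro powr_mono2) auto
  also have "\<dots> = (\<integral>y. \<bar>k y\<bar> \<partial>lebesgue) * Lp_norm p (lebesgue_on E) u"
    unfolding Lp_norm_lebesgue_on[OF E] using p by (simp add: powr_mult powr_powr)
  finally show "Lp_norm p (lebesgue_on E) (correlation E k u)
       \<le> (\<integral>z. \<bar>k z\<bar> \<partial>lebesgue) * Lp_norm p (lebesgue_on E) u" .
qed

section \<open>Density of Lipschitz functions in \<open>L\<^sup>1\<close>\<close>

text \<open>As \<open>c\<close> grows, these tents decrease to the indicator of \<open>T\<close> if \<open>T\<close> is closed and nonempty.\<close>

lemma infdist_cutoff_lipschitz:
  fixes T :: "'a::metric_space set"
  assumes "0 \<le> c"
  shows "c-lipschitz_on UNIV (\<lambda>x. max 0 (1 - c * infdist x T))"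
proof (rule lipschitz_onI)
  fix x y :: 'a
  have "\<bar>max 0 (1 - c * infdist x T) - max 0 (1 - c * infdist y T)\<bar> \<le> \<bar>c * (infdist x T - infdist y T)\<bar>"
    by (auto simp: max_def abs_if algebra_simps)
  also have "\<dots> \<le> c * dist x y"
    using assms infdist_triangle_abs[of x T y] by (simp add: abs_mult mult_left_mono)
  finally show "dist (max 0 (1 - c * infdist x T)) (max 0 (1 - c * infdist y T)) \<le> c * dist x y"
    by (simp add: dist_real_def)
qed (rule assms)

lemma lipschitz_borel_measurable:
  fixes g :: "'a::euclidean_space \<Rightarrow> real"
  assumes "L-lipschitz_on UNIV g"
  shows "g \<in> borel_measurable lebesgue"
  by (rule measurable_completion)
     (simp add: borel_measurable_continuous_onI[OF lipschitz_on_continuous_on[OF assms]])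

lemma lipschitz_approx_indicator_compact:
  fixes T :: "'a::euclidean_space set"
  assumes T: "compact T" and e: "e > 0"
  shows "\<exists>g L. L-lipschitz_on UNIV g \<and> integrable lebesgue g \<and> (\<integral>x. \<bar>indicator T x - g x\<bar> \<partial>lebesgue) < (e::real)"
proof (cases "T = {}")
  case True
  then show ?thesis using e by (intro exI[of _ "\<lambda>_. 0"] exI[of _ 0]) (auto simp: lipschitz_on_constant)
next
  case False
  define g where "g n x = max 0 (1 - real (Suc n) * infdist x T)" for n x
  have lip: "(real (Suc n))-lipschitz_on UNIV (g n)" for n
    unfolding g_def by (rule infdist_cutoff_lipschitz) simp
  have meas: "g n \<in> borel_measurable lebesgue" for n
    by (rule lipschitz_borel_measurable[OF lip])
  obtain r where r: "r > 0" "\<And>x. x \<in> T \<Longrightarrow> norm x \<le> r"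
    using compact_imp_bounded[OF T] by (auto simp: bounded_pos)
  have dom: "\<bar>g n x\<bar> \<le> indicator (cball 0 (r + 1)) x" for n x
  proof (cases "x \<in> cball 0 (r + 1)")
    case True
    have "0 \<le> real (Suc n) * infdist x T" by (simp add: infdist_nonneg)
    then show ?thesis using True by (simp add: g_def)
  next
    case False
    obtain t where t: "t \<in> T" "infdist x T = dist x t"
      using infdist_attains_inf[OF compact_imp_closed[OF T] \<open>T \<noteq> {}\<close>] by auto
    have "1 \<le> infdist x T"
      using False r(2)[OF t(1)] norm_triangle_ineq2[of x t] by (simp add: t(2) dist_norm)
    then have "1 * 1 \<le> real (Suc n) * infdist x T" by (intro mult_mono) auto
    then show ?thesis by (simp add: g_def)
  qed
  have int_dom: "integrable lebesgue (indicator (cball 0 (r + 1)) :: 'a \<Rightarrow> real)"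
    using lmeasurable_compact[OF compact_cball] by (auto simp: integrable_indicator_iff fmeasurable_def)
  have int: "integrable lebesgue (g n)" for n
    by (rule Bochner_Integration.integrable_bound[OF int_dom meas]) (use dom in auto)
  have intT: "integrable lebesgue (indicator T :: 'a \<Rightarrow> real)"
    using lmeasurable_compact[OF T] by (auto simp: integrable_indicator_iff fmeasurable_def)
  have lim: "(\<lambda>n. g n x) \<longlonglongrightarrow> indicator T x" for x
  proof (cases "x \<in> T")
    case True
    then show ?thesis by (simp add: g_def)
  next
    case x: False
    then have "infdist x T > 0"
      using in_closed_iff_infdist_zero[OF compact_imp_closed[OF T] \<open>T \<noteq> {}\<close>] infdist_nonneg[of x T]
      by (metis order_le_less)
    then obtain N where N: "1 < real N * infdist x T" using reals_Archimedean3 by blast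
    have "g n x = 0" if "n \<ge> N" for n
    proof -
      have "real N * infdist x T \<le> real (Suc n) * infdist x T"
        using that by (intro mult_right_mono) (auto simp: infdist_nonneg)
      then show ?thesis using N by (simp add: g_def)
    qed
    then have "eventually (\<lambda>n. g n x = indicator T x) sequentially"
      using x by (auto simp: eventually_sequentially)
    then show ?thesis by (rule tendsto_eventually)
  qed
  have "(\<lambda>n. \<integral>x. \<bar>indicator T x - g n x\<bar> \<partial>lebesgue) \<longlonglongrightarrow> (\<integral>x. 0 \<partial>(lebesgue :: 'a measure))"
  proof (rule integral_dominated_convergence)
    show "AE x in lebesgue. (\<lambda>n. \<bar>indicator T x - g n x\<bar>) \<longlonglongrightarrow> 0"
    proof (rule AE_I2)
      fix x
      have "(\<lambda>n. \<bar>indicator T x - g n x\<bar>) \<longlonglongrightarrow> \<bar>indicator T x - indicator T x\<bar>"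
        by (intro tendsto_rabs tendsto_diff tendsto_const lim)
      then show "(\<lambda>n. \<bar>indicator T x - g n x\<bar>) \<longlonglongrightarrow> 0" by simp
    qed
    show "integrable lebesgue (\<lambda>x. indicator T x + indicator (cball 0 (r + 1)) x :: real)"
      using intT int_dom by simp
    show "AE x in lebesgue. norm \<bar>indicator T x - g n x\<bar> \<le> indicator T x + indicator (cball 0 (r + 1)) x" for n
    proof (rule AE_I2)
      fix x
      show "norm \<bar>indicator T x - g n x\<bar> \<le> indicator T x + indicator (cball 0 (r + 1)) x"
        using dom[of n x] abs_triangle_ineq4[of "indicator T x" "g n x"] by simp
    qed
    show "(\<lambda>x. \<bar>indicator T x - g n x\<bar>) \<in> borel_measurable lebesgue" for n
      using meas intT by auto
  qed simp
  then have "eventually (\<lambda>n. (\<integral>x. \<bar>indicator T x - g n x\<bar> \<partial>lebesgue) < e) sequentially"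
    using e by (intro order_tendstoD(2)) auto
  then obtain n where "(\<integral>x. \<bar>indicator T x - g n x\<bar> \<partial>lebesgue) < e"
    by (auto simp: eventually_sequentially)
  then show ?thesis using lip int by blast
qed

text \<open>The functions that can be approximated are closed under \<open>L\<^sup>1\<close> limits, sums and multiples. They contain
  indicators of compact sets, hence of bounded measurable sets by inner regularity, hence of all sets of finite
  measure by exhaustion with balls, and these indicators generate everything.\<close>

theorem lipschitz_dense_in_L1:
  fixes k :: "'a::euclidean_space \<Rightarrow> real"
  assumes k: "integrable lebesgue k" and "e > 0"
  shows "\<exists>g L. L-lipschitz_on UNIV g \<and> integrable lebesgue g \<and> (\<integral>x. \<bar>k x - g x\<bar> \<partial>lebesgue) < e"
proof -
  define P where "P k \<longleftrightarrow> (\<forall>e>0. \<exists>g L. L-lipschitz_on UNIV g \<and> integrable lebesgue g \<and>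
      (\<integral>x. \<bar>k x - g x\<bar> \<partial>lebesgue) < e)" for k :: "'a \<Rightarrow> real"
  have triangle: "(\<integral>x. \<bar>f x - g x\<bar> \<partial>lebesgue) \<le> (\<integral>x. \<bar>f x - h x\<bar> \<partial>lebesgue) + (\<integral>x. \<bar>h x - g x\<bar> \<partial>lebesgue)"
    if "integrable lebesgue f" "integrable lebesgue g" "integrable lebesgue h" for f g h :: "'a \<Rightarrow> real"
  proof -
    have "(\<integral>x. \<bar>f x - g x\<bar> \<partial>lebesgue) \<le> (\<integral>x. (\<bar>f x - h x\<bar> + \<bar>h x - g x\<bar>) \<partial>lebesgue)"
      using that by (intro integral_mono) auto
    then show ?thesis using that by simp
  qed
  have close: "P f" if f: "integrable lebesgue f"
    and approx: "\<And>e. e > 0 \<Longrightarrow> \<exists>h. integrable lebesgue h \<and> P h \<and> (\<integral>x. \<bar>f x - h x\<bar> \<partial>lebesgue) < e"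
    for f
    unfolding P_def
  proof (intro allI impI)
    fix e :: real assume "e > 0"
    then have e2: "e / 2 > 0" by simp
    obtain h where h: "integrable lebesgue h" "P h" "(\<integral>x. \<bar>f x - h x\<bar> \<partial>lebesgue) < e / 2"
      using approx[OF e2] by blast
    obtain g L where g: "L-lipschitz_on UNIV g" "integrable lebesgue g" "(\<integral>x. \<bar>h x - g x\<bar> \<partial>lebesgue) < e / 2"
      using h(2) e2 unfolding P_def by blast
    have "(\<integral>x. \<bar>f x - g x\<bar> \<partial>lebesgue) < e" using triangle[OF f g(2) h(1)] h(3) g(3) by simp
    then show "\<exists>g L. L-lipschitz_on UNIV g \<and> integrable lebesgue g \<and> (\<integral>x. \<bar>f x - g x\<bar> \<partial>lebesgue) < e"
      using g by blast
  qed
  have close_lim: "P f" if f: "integrable lebesgue f" and s: "\<And>i. integrable lebesgue (s i)" "\<And>i. P (s i)"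
    and lim: "\<And>x. (\<lambda>i. s i x) \<longlonglongrightarrow> f x" and bd: "\<And>i x. \<bar>s i x\<bar> \<le> 2 * \<bar>f x\<bar>"
    for f and s :: "nat \<Rightarrow> 'a \<Rightarrow> real"
  proof (rule close[OF f])
    fix e :: real assume "e > 0"
    have "(\<lambda>n. \<integral>x. \<bar>f x - s n x\<bar> \<partial>lebesgue) \<longlonglongrightarrow> (\<integral>x. 0 \<partial>(lebesgue :: 'a measure))"
    proof (rule integral_dominated_convergence)
      show "AE x in lebesgue. (\<lambda>n. \<bar>f x - s n x\<bar>) \<longlonglongrightarrow> 0"
      proof (rule AE_I2)
        fix x
        have "(\<lambda>n. \<bar>f x - s n x\<bar>) \<longlonglongrightarrow> \<bar>f x - f x\<bar>"
          by (intro tendsto_rabs tendsto_diff tendsto_const lim)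
        then show "(\<lambda>n. \<bar>f x - s n x\<bar>) \<longlonglongrightarrow> 0" by simp
      qed
      show "integrable lebesgue (\<lambda>x. 3 * \<bar>f x\<bar>)" using f by simp
      show "AE x in lebesgue. norm \<bar>f x - s n x\<bar> \<le> 3 * \<bar>f x\<bar>" for n
      proof (rule AE_I2)
        fix x show "norm \<bar>f x - s n x\<bar> \<le> 3 * \<bar>f x\<bar>" using bd[of n x] by (simp add: abs_if split: if_splits)
      qed
    qed (use f s in auto)
    then have "eventually (\<lambda>n. (\<integral>x. \<bar>f x - s n x\<bar> \<partial>lebesgue) < e) sequentially"
      using \<open>e > 0\<close> by (intro order_tendstoD(2)) auto
    then show "\<exists>h. integrable lebesgue h \<and> P h \<and> (\<integral>x. \<bar>f x - h x\<bar> \<partial>lebesgue) < e"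
      using s by (auto simp: eventually_sequentially)
  qed
  have bounded_set: "P (indicator A)" if A: "A \<in> sets lebesgue" "bounded A" for A
  proof (rule close)
    have intA: "integrable lebesgue (indicator B :: 'a \<Rightarrow> real)" if "B \<in> sets lebesgue" "B \<subseteq> A" for B
      using bounded_set_imp_lmeasurable[OF bounded_subset[OF A(2) that(2)] that(1)]
      by (auto simp: integrable_indicator_iff fmeasurable_def)
    show "integrable lebesgue (indicator A :: 'a \<Rightarrow> real)" using intA A by simp
    fix e :: real assume "e > 0"
    then obtain T where T: "closed T" "T \<subseteq> A" "A - T \<in> lmeasurable" "emeasure lebesgue (A - T) < ennreal e"
      using sets_lebesgue_inner_closed[OF A(1)] by metis
    have "compact T" using T(1,2) A(2) bounded_subset compact_eq_bounded_closed by blast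
    then have "P (indicator T)" unfolding P_def using lipschitz_approx_indicator_compact by blast
    moreover have "(\<integral>x. \<bar>indicator A x - indicator T x :: real\<bar> \<partial>lebesgue) < e"
    proof -
      have "(\<lambda>x. \<bar>indicator A x - indicator T x :: real\<bar>) = indicator (A - T)"
        using T(2) by (auto simp: indicator_def fun_eq_iff)
      moreover have "measure lebesgue (A - T) < e"
        using T(3,4) \<open>e > 0\<close> by (subst (asm) emeasure_eq_measure2) (auto simp: ennreal_less_iff)
      ultimately show ?thesis by simp
    qed
    moreover have "T \<in> sets lebesgue" using T(1) by auto
    ultimately show "\<exists>h. integrable lebesgue h \<and> P h \<and> (\<integral>x. \<bar>indicator A x - h x\<bar> \<partial>lebesgue) < e"
      using intA T(2) by blast
  qed
  have "P k"
    using k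
  proof induct
    case (base A c)
    have iA: "integrable lebesgue (indicator A :: 'a \<Rightarrow> real)" using base by (simp add: integrable_indicator_iff)
    have PA: "P (indicator A)"
    proof (rule close_lim[where s = "\<lambda>n. indicator (A \<inter> cball 0 (real n))"])
      have "cball (0::'a) (real n) \<in> sets lebesgue" for n by auto
      then have sets: "A \<inter> cball 0 (real n) \<in> sets lebesgue" for n using base(1) by blast
      then show "P (indicator (A \<inter> cball 0 (real n)))" for n by (intro bounded_set) (auto intro: bounded_subset)
      show "integrable lebesgue (indicator (A \<inter> cball 0 (real n)) :: 'a \<Rightarrow> real)" for n
        by (rule Bochner_Integration.integrable_bound[OF iA]) (use sets in \<open>auto simp: indicator_def\<close>)
      show "(\<lambda>n. indicator (A \<inter> cball 0 (real n)) x :: real) \<longlonglongrightarrow> indicator A x" for x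
      proof (rule tendsto_eventually)
        obtain N where "norm x \<le> real N" using real_arch_simple by blast
        then show "eventually (\<lambda>n. indicator (A \<inter> cball 0 (real n)) x = (indicator A x :: real)) sequentially"
          by (auto simp: eventually_sequentially indicator_def intro!: exI[of _ N])
      qed
    qed (use iA in \<open>auto simp: indicator_def\<close>)
    show "P (\<lambda>x. indicator A x *\<^sub>R c)"
      unfolding P_def
    proof (intro allI impI)
      fix e :: real assume "e > 0"
      then have "e / (\<bar>c\<bar> + 1) > 0" by simp
      then obtain g L where g: "L-lipschitz_on UNIV g" "integrable lebesgue g"
        "(\<integral>x. \<bar>indicator A x - g x\<bar> \<partial>lebesgue) < e / (\<bar>c\<bar> + 1)" using PA unfolding P_def by blast
      have "\<bar>indicator A x *\<^sub>R c - c * g x\<bar> = \<bar>c\<bar> * \<bar>indicator A x - g x\<bar>" for x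
        by (simp add: abs_mult[symmetric] algebra_simps)
      then have "(\<integral>x. \<bar>indicator A x *\<^sub>R c - c * g x\<bar> \<partial>lebesgue) = \<bar>c\<bar> * (\<integral>x. \<bar>indicator A x - g x\<bar> \<partial>lebesgue)"
        by simp
      also have "\<dots> \<le> (\<bar>c\<bar> + 1) * (\<integral>x. \<bar>indicator A x - g x\<bar> \<partial>lebesgue)"
        by (intro mult_right_mono) auto
      also have "\<dots> < e"
        using g(3) by (simp add: field_simps add_pos_nonneg)
      finally show "\<exists>g L. L-lipschitz_on UNIV g \<and> integrable lebesgue g \<and>
          (\<integral>x. \<bar>indicator A x *\<^sub>R c - g x\<bar> \<partial>lebesgue) < e"
        using lipschitz_on_cmult_real[OF g(1), of c] g(2)
        by (intro exI[of _ "\<lambda>x. c * g x"] exI[of _ "\<bar>c\<bar> * L"]) auto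
    qed
  next
    case (add f g)
    show "P (\<lambda>x. f x + g x)"
      unfolding P_def
    proof (intro allI impI)
      fix e :: real assume "e > 0"
      then have e2: "e / 2 > 0" by simp
      obtain a K where a: "K-lipschitz_on UNIV a" "integrable lebesgue a" "(\<integral>x. \<bar>f x - a x\<bar> \<partial>lebesgue) < e / 2"
        using add(2) e2 unfolding P_def by blast
      obtain b L where b: "L-lipschitz_on UNIV b" "integrable lebesgue b" "(\<integral>x. \<bar>g x - b x\<bar> \<partial>lebesgue) < e / 2"
        using add(4) e2 unfolding P_def by blast
      have "(\<integral>x. \<bar>(f x + g x) - (a x + b x)\<bar> \<partial>lebesgue) \<le> (\<integral>x. (\<bar>f x - a x\<bar> + \<bar>g x - b x\<bar>) \<partial>lebesgue)"
        using a b add by (intro integral_mono) auto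
      also have "\<dots> = (\<integral>x. \<bar>f x - a x\<bar> \<partial>lebesgue) + (\<integral>x. \<bar>g x - b x\<bar> \<partial>lebesgue)"
        using a b add by (intro Bochner_Integration.integral_add) auto
      also have "\<dots> < e" using a b by simp
      finally show "\<exists>h L. L-lipschitz_on UNIV h \<and> integrable lebesgue h \<and>
          (\<integral>x. \<bar>(f x + g x) - h x\<bar> \<partial>lebesgue) < e"
        using lipschitz_on_add[OF a(1) b(1)] a(2) b(2)
        by (intro exI[of _ "\<lambda>x. a x + b x"] exI[of _ "K + L"]) auto
    qed
  next
    case (lim f s)
    show "P f" by (rule close_lim[where s = s]) (use lim in auto)
  qed
  then show ?thesis using \<open>e > 0\<close> unfolding P_def by blast
qed

section \<open>Compactness of correlation operators\<close>

lemma Lp_norm_const: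
  assumes "1 \<le> p" "E \<in> lmeasurable"
  shows "(\<lambda>_. c) \<in> Lp_fun p (lebesgue_on E)"
    and "Lp_norm p (lebesgue_on E) (\<lambda>_. c) = \<bar>c\<bar> * measure lebesgue E powr (1 / p)"
proof -
  have "finite_measure (lebesgue_on E)" using assms(2) by (simp add: finite_measure_lebesgue_on)
  then show "(\<lambda>_. c) \<in> Lp_fun p (lebesgue_on E)" by (simp add: Lp_fun_def finite_measure.integrable_const)
  show "Lp_norm p (lebesgue_on E) (\<lambda>_. c) = \<bar>c\<bar> * measure lebesgue E powr (1 / p)"
    using assms by (simp add: Lp_norm_def measure_restrict_space fmeasurableD powr_mult powr_powr)
qed

text \<open>On a set of finite measure \<open>L\<^sup>p\<close> is contained in \<open>L\<^sup>1\<close>, by integrating \<open>\<bar>t\<bar> \<le> 1 + \<bar>t\<bar> powr p\<close>. The crude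
  bound suffices, since only boundedness of the \<open>L\<^sup>1\<close> norms matters later.\<close>

lemma Lp_imp_L1:
  assumes p: "1 \<le> p" and E: "E \<in> lmeasurable" and u: "u \<in> Lp_fun p (lebesgue_on E)"
  shows "integrable lebesgue (\<lambda>y. indicator E y * u y)"
    and "(\<integral>y. \<bar>indicator E y * u y\<bar> \<partial>lebesgue)
      \<le> measure lebesgue E + Lp_norm p (lebesgue_on E) u powr p"
proof -
  have Es: "E \<in> sets lebesgue" using E by (rule fmeasurableD)
  have Eu: "(\<lambda>y. indicator E y * u y) \<in> borel_measurable lebesgue"
    "integrable lebesgue (\<lambda>y. \<bar>indicator E y * u y\<bar> powr p)"
    using u by (simp_all add: Lp_fun_lebesgue_on_iff[OF Es])
  have iE: "integrable lebesgue (indicator E :: 'a \<Rightarrow> real)"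
    using E by (auto simp: integrable_indicator_iff fmeasurable_def)
  have le: "\<bar>indicator E y * u y\<bar> \<le> indicator E y + \<bar>indicator E y * u y\<bar> powr p" for y
  proof (cases "\<bar>u y\<bar> \<le> 1")
    case False
    then have "\<bar>u y\<bar> powr 1 \<le> \<bar>u y\<bar> powr p" using p by (intro powr_mono) auto
    then show ?thesis by (simp add: indicator_def)
  qed (simp add: indicator_def add_increasing2)
  have i2: "integrable lebesgue (\<lambda>y. indicator E y + \<bar>indicator E y * u y\<bar> powr p)"
    using iE Eu(2) by simp
  show i: "integrable lebesgue (\<lambda>y. indicator E y * u y)"
    by (rule Bochner_Integration.integrable_bound[OF i2 Eu(1)])
      (use le in \<open>auto intro!: AE_I2 order_trans[OF _ abs_ge_self]\<close>)
  have "(\<integral>y. \<bar>indicator E y * u y\<bar> \<partial>lebesgue) \<le> (\<integral>y. (indicator E y + \<bar>indicator E y * u y\<bar> powr p) \<partial>lebesgue)"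
    using i by (intro integral_mono i2 le) auto
  also have "\<dots> = measure lebesgue E + (\<integral>y. \<bar>indicator E y * u y\<bar> powr p \<partial>lebesgue)"
    using iE Eu(2) Es by simp
  also have "(\<integral>y. \<bar>indicator E y * u y\<bar> powr p \<partial>lebesgue) = Lp_norm p (lebesgue_on E) u powr p"
    unfolding Lp_norm_lebesgue_on[OF Es] using p by (simp add: powr_powr)
  finally show "(\<integral>y. \<bar>indicator E y * u y\<bar> \<partial>lebesgue)
      \<le> measure lebesgue E + Lp_norm p (lebesgue_on E) u powr p" .
qed

text \<open>A Lipschitz kernel is bounded on bounded sets, and translating it changes it uniformly little; both
  pass to the correlation, at the price of the \<open>L\<^sup>1\<close> norm of \<open>u\<close>.\<close>

lemma lipschitz_correlation_bounds:
  fixes g :: "'a::euclidean_space \<Rightarrow> real"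
  assumes E: "E \<in> sets lebesgue" and g: "L-lipschitz_on UNIV g"
    and Eu: "integrable lebesgue (\<lambda>y. indicator E y * u y)"
    and D: "\<And>y. y \<in> E \<Longrightarrow> norm (y - x) \<le> D" and D': "\<And>y. y \<in> E \<Longrightarrow> norm (y - x') \<le> D"
  shows "\<bar>correlation E g u x\<bar> \<le> (\<bar>g 0\<bar> + L * D) * (\<integral>y. \<bar>indicator E y * u y\<bar> \<partial>lebesgue)"
    and "\<bar>correlation E g u x - correlation E g u x'\<bar>
      \<le> L * dist x x' * (\<integral>y. \<bar>indicator E y * u y\<bar> \<partial>lebesgue)"
proof -
  have L: "0 \<le> L" by (rule lipschitz_on_nonneg[OF g])
  have bound: "\<bar>indicator E y * u y * g (y - z)\<bar> \<le> (\<bar>g 0\<bar> + L * D) * \<bar>indicator E y * u y\<bar>"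
    if D: "\<And>y. y \<in> E \<Longrightarrow> norm (y - z) \<le> D" for y z
  proof (cases "y \<in> E")
    case True
    have "\<bar>g (y - z) - g 0\<bar> \<le> L * norm (y - z)"
      using lipschitz_onD[OF g, of "y - z" 0] by (simp add: dist_real_def)
    also have "\<dots> \<le> L * D" using D[OF True] L by (rule mult_left_mono)
    finally have "\<bar>g (y - z)\<bar> \<le> \<bar>g 0\<bar> + L * D" by linarith
    then have "\<bar>u y\<bar> * \<bar>g (y - z)\<bar> \<le> \<bar>u y\<bar> * (\<bar>g 0\<bar> + L * D)" by (intro mult_left_mono) auto
    then show ?thesis using True by (simp add: abs_mult mult.commute)
  qed simp
  have "(\<lambda>y. g (y - z)) \<in> borel_measurable lebesgue" for z
    by (rule lipschitz_borel_measurable[of L])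
       (use lipschitz_onD[OF g, of "_ - z" "_ - z"] L in \<open>auto intro!: lipschitz_onI simp: dist_norm\<close>)
  then have meas: "(\<lambda>y. indicator E y * u y * g (y - z)) \<in> borel_measurable lebesgue" for z
    using Eu by auto
  have absi: "integrable lebesgue (\<lambda>y. \<bar>indicator E y * u y\<bar>)" using Eu by (rule integrable_abs)
  have int: "integrable lebesgue (\<lambda>y. indicator E y * u y * g (y - z))"
    if "\<And>y. y \<in> E \<Longrightarrow> norm (y - z) \<le> D" for z
    by (rule Bochner_Integration.integrable_bound[OF integrable_mult_right[OF absi, of "\<bar>g 0\<bar> + L * D"] meas])
      (use bound[OF that] in \<open>auto intro!: AE_I2 order_trans[OF _ abs_ge_self]\<close>)
  have "\<bar>correlation E g u x\<bar> \<le> (\<integral>y. \<bar>indicator E y * u y * g (y - x)\<bar> \<partial>lebesgue)"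
    unfolding correlation_def by (rule integral_abs_bound)
  also have "\<dots> \<le> (\<integral>y. (\<bar>g 0\<bar> + L * D) * \<bar>indicator E y * u y\<bar> \<partial>lebesgue)"
    by (rule integral_mono[OF integrable_abs[OF int[OF D]] integrable_mult_right[OF absi] bound[OF D]])
  finally show "\<bar>correlation E g u x\<bar> \<le> (\<bar>g 0\<bar> + L * D) * (\<integral>y. \<bar>indicator E y * u y\<bar> \<partial>lebesgue)" by simp
  have "correlation E g u x - correlation E g u x'
      = (\<integral>y. (indicator E y * u y * g (y - x) - indicator E y * u y * g (y - x')) \<partial>lebesgue)"
    unfolding correlation_def using int[OF D] int[OF D'] by simp
  also have "\<bar>\<dots>\<bar> \<le> (\<integral>y. \<bar>indicator E y * u y * g (y - x) - indicator E y * u y * g (y - x')\<bar> \<partial>lebesgue)"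
    by (rule integral_abs_bound)
  also have "\<dots> \<le> (\<integral>y. L * dist x x' * \<bar>indicator E y * u y\<bar> \<partial>lebesgue)"
  proof (rule integral_mono)
    fix y
    have "\<bar>g (y - x) - g (y - x')\<bar> \<le> L * dist x x'"
      using lipschitz_onD[OF g, of "y - x" "y - x'"] by (simp add: dist_real_def dist_norm norm_minus_commute)
    then have "\<bar>indicator E y * u y\<bar> * \<bar>g (y - x) - g (y - x')\<bar> \<le> \<bar>indicator E y * u y\<bar> * (L * dist x x')"
      by (intro mult_left_mono) auto
    then show "\<bar>indicator E y * u y * g (y - x) - indicator E y * u y * g (y - x')\<bar>
        \<le> L * dist x x' * \<bar>indicator E y * u y\<bar>"
      by (simp only: abs_mult right_diff_distrib[symmetric] mult.commute mult.left_commute)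
  qed (use int[OF D] int[OF D'] absi in auto)
  finally show "\<bar>correlation E g u x - correlation E g u x'\<bar>
      \<le> L * dist x x' * (\<integral>y. \<bar>indicator E y * u y\<bar> \<partial>lebesgue)" by simp
qed

text \<open>The argument of Arzela and Ascoli: the colour of \<open>u\<close> lists the values of its correlation at the points
  of a finite net, rounded to multiples of \<open>s / 4\<close>. The uniform bound leaves finitely many colours,
  and equicontinuity carries the agreement from the net to all of \<open>E\<close> with total error below \<open>s\<close>.\<close>

lemma Lp_precompact_on_lipschitz_correlation:
  fixes g :: "'a::euclidean_space \<Rightarrow> real"
  assumes p: "1 \<le> p" and E: "E \<in> sets lebesgue" "bounded E"
    and g: "L-lipschitz_on UNIV g" "integrable lebesgue g"
  shows "Lp_precompact_on p (lebesgue_on E) (correlation E g)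
    {u \<in> Lp_fun p (lebesgue_on E). Lp_norm p (lebesgue_on E) u \<le> R}"
proof (rule Lp_precompact_onI)
  fix e :: real assume e: "e > 0"
  let ?M = "lebesgue_on E"
  define B where "B = {u \<in> Lp_fun p ?M. Lp_norm p ?M u \<le> R}"
  have Em: "E \<in> lmeasurable" using E by (simp add: bounded_set_imp_lmeasurable)
  define m where "m = measure lebesgue E"
  \<comment> \<open>A uniform error \<open>s\<close> on \<open>E\<close> costs \<open>s * m powr (1 / p)\<close> in norm; the summand 1 gives strictness and excludes division by 0.\<close>
  define s where "s = e / (1 + m powr (1 / p))"
  have s: "s > 0" using e by (auto simp: s_def intro!: divide_pos_pos add_pos_nonneg)
  have L: "0 \<le> L" by (rule lipschitz_on_nonneg[OF g(1)])
  obtain D where D: "D \<ge> 0" "\<And>x. x \<in> closure E \<Longrightarrow> norm x \<le> D"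
    using bounded_closure[OF E(2)] unfolding bounded_pos by (meson less_imp_le)
  have diam: "norm (y - x) \<le> 2 * D" if "x \<in> closure E" "y \<in> E" for x y
    using norm_triangle_ineq4[of y x] D(2)[of x] D(2)[of y] that closure_subset[of E] by force
  define Q where "Q = \<bar>g 0\<bar> + L * (2 * D)"
  have Q: "0 \<le> Q" using L D by (simp add: Q_def)
  define C where "C = m + \<bar>R\<bar> powr p"
  have C: "0 \<le> C" by (simp add: C_def m_def)
  have uC: "integrable lebesgue (\<lambda>y. indicator E y * u y)" "(\<integral>y. \<bar>indicator E y * u y\<bar> \<partial>lebesgue) \<le> C"
    if "u \<in> B" for u
  proof -
    have u: "u \<in> Lp_fun p ?M" "Lp_norm p ?M u \<le> R" using that by (auto simp: B_def)
    show "integrable lebesgue (\<lambda>y. indicator E y * u y)" by (rule Lp_imp_L1[OF p Em u(1)])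
    have "Lp_norm p ?M u powr p \<le> \<bar>R\<bar> powr p" using u p by (intro powr_mono2) auto
    then show "(\<integral>y. \<bar>indicator E y * u y\<bar> \<partial>lebesgue) \<le> C"
      using Lp_imp_L1(2)[OF p Em u(1)] by (simp add: C_def m_def)
  qed
  \<comment> \<open>Points closer than \<open>\<eta>\<close> have correlations within \<open>s / 4\<close> of each other.\<close>
  define \<eta> where "\<eta> = s / (4 * (L * C + 1))"
  have LC: "0 \<le> L * C" using L C by simp
  have \<eta>: "\<eta> > 0" using s LC by (simp add: \<eta>_def)
  have bd: "\<bar>correlation E g u x\<bar> \<le> Q * C" if "u \<in> B" "x \<in> closure E" for u x
  proof -
    have "\<bar>correlation E g u x\<bar> \<le> Q * (\<integral>y. \<bar>indicator E y * u y\<bar> \<partial>lebesgue)"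
      unfolding Q_def using that
      by (intro lipschitz_correlation_bounds(1)[OF E(1) g(1) uC(1), where D = "2 * D"] diam)
    also have "\<dots> \<le> Q * C" using uC(2)[OF that(1)] Q by (rule mult_left_mono)
    finally show ?thesis .
  qed
  have equi: "\<bar>correlation E g u x - correlation E g u x'\<bar> \<le> s / 4"
    if "u \<in> B" "x \<in> closure E" "x' \<in> closure E" "dist x x' < \<eta>" for u x x'
  proof -
    have "\<bar>correlation E g u x - correlation E g u x'\<bar>
        \<le> L * dist x x' * (\<integral>y. \<bar>indicator E y * u y\<bar> \<partial>lebesgue)"
      using that by (intro lipschitz_correlation_bounds(2)[OF E(1) g(1) uC(1), where D = "2 * D"] diam)
    also have "\<dots> \<le> L * \<eta> * C"
      using that uC(2)[OF that(1)] L \<eta> by (intro mult_mono) (auto intro: mult_left_mono)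
    also have "\<dots> \<le> (L * C + 1) * \<eta>" using \<eta> by (simp add: algebra_simps)
    also have "\<dots> = s / 4" using LC by (simp add: \<eta>_def field_simps)
    finally show ?thesis .
  qed
  have "compact (closure E)" using E(2) by (simp add: compact_closure)
  then have "\<exists>K. finite K \<and> K \<subseteq> closure E \<and> closure E \<subseteq> (\<Union>x\<in>K. ball x \<eta>)"
    using seq_compact_imp_totally_bounded \<eta> by (metis compact_imp_seq_compact)
  then obtain K where K: "finite K" "K \<subseteq> closure E" "closure E \<subseteq> (\<Union>x\<in>K. ball x \<eta>)" by blast
  define \<phi> where "\<phi> u = restrict (\<lambda>x. \<lfloor>correlation E g u x * (4 / s)\<rfloor>) K" for u
  have fin: "finite (\<phi> ` B)"
  proof (rule finite_subset)
    define N where "N = \<lceil>Q * C * (4 / s)\<rceil> + 1"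
    show "\<phi> ` B \<subseteq> PiE K (\<lambda>_. {-N..N})"
    proof (clarify)
      fix u assume u: "u \<in> B"
      show "\<phi> u \<in> PiE K (\<lambda>_. {-N..N})"
        unfolding \<phi>_def
      proof (rule restrict_PiE_iff[THEN iffD2], rule ballI)
        fix x assume "x \<in> K"
        then have "\<bar>correlation E g u x\<bar> * (4 / s) \<le> Q * C * (4 / s)"
          using bd[OF u] K(2) s by (intro mult_right_mono) auto
        then have "\<bar>correlation E g u x * (4 / s)\<bar> \<le> Q * C * (4 / s)" using s by (simp add: abs_mult)
        then show "\<lfloor>correlation E g u x * (4 / s)\<rfloor> \<in> {-N..N}" 
          using le_of_int_ceiling[of "Q * C * (4 / s)"] unfolding N_def atLeastAtMost_iff
          by (intro conjI) linarith+
      qed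
    qed
    show "finite (PiE K (\<lambda>_. {-N..N}))" using K(1) by (intro finite_PiE) auto
  qed
  have close: "Lp_norm p ?M (\<lambda>x. correlation E g u x - correlation E g v x) < e"
    if uv: "u \<in> B" "v \<in> B" "\<phi> u = \<phi> v" for u v
  proof -
    have pw: "\<bar>correlation E g u x - correlation E g v x\<bar> \<le> \<bar>s\<bar>" if "x \<in> E" for x
    proof -
      have x: "x \<in> closure E" using that closure_subset by blast
      then obtain z where z: "z \<in> K" "dist x z < \<eta>" using K(3) by (auto simp: dist_commute)
      have zc: "z \<in> closure E" using z K(2) by blast
      have "\<lfloor>correlation E g u z * (4 / s)\<rfloor> = \<lfloor>correlation E g v z * (4 / s)\<rfloor>"
        using fun_cong[OF uv(3), of z] z(1) by (simp add: \<phi>_def)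
      then have "\<bar>correlation E g u z * (4 / s) - correlation E g v z * (4 / s)\<bar> \<le> 1" by linarith
      moreover have "\<bar>correlation E g u z * (4 / s) - correlation E g v z * (4 / s)\<bar>
          = \<bar>correlation E g u z - correlation E g v z\<bar> * (4 / s)"
        using s by (simp only: left_diff_distrib[symmetric] abs_mult) simp
      ultimately have "\<bar>correlation E g u z - correlation E g v z\<bar> * (4 / s) \<le> 1" by simp
      then have "\<bar>correlation E g u z - correlation E g v z\<bar> \<le> s / 4" using s by (simp add: field_simps)
      then show ?thesis using equi[OF uv(1) x zc z(2)] equi[OF uv(2) x zc z(2)] s by linarith
    qed
    have Lp: "correlation E g u \<in> Lp_fun p ?M" "correlation E g v \<in> Lp_fun p ?M"
      using uv correlation_in_Lp[OF p E(1) _ g(2)] by (auto simp: B_def)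
    then have "(\<lambda>x. correlation E g u x - correlation E g v x) \<in> borel_measurable ?M"
      by (auto simp: Lp_fun_def)
    then have "Lp_norm p ?M (\<lambda>x. correlation E g u x - correlation E g v x) \<le> Lp_norm p ?M (\<lambda>_. s)"
      by (rule Lp_norm_le_of_abs_le(2)[OF p _ Lp_norm_const(1)[OF p Em]]) (use pw in auto)
    also have "\<dots> = s * m powr (1 / p)" using s by (simp add: Lp_norm_const(2)[OF p Em] m_def)
    also have "\<dots> < s * (1 + m powr (1 / p))" using s by simp
    also have "\<dots> = e" 
    proof -
      have "1 + m powr (1 / p) > 0" by (simp add: add_pos_nonneg)
      then show ?thesis by (simp add: s_def)
    qed
    finally show ?thesis .
  qed
  show "\<exists>\<phi> :: ('a \<Rightarrow> real) \<Rightarrow> ('a \<Rightarrow> int). finite (\<phi> ` {u \<in> Lp_fun p ?M. Lp_norm p ?M u \<le> R}) \<and>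
     (\<forall>u\<in>{u \<in> Lp_fun p ?M. Lp_norm p ?M u \<le> R}. \<forall>v\<in>{u \<in> Lp_fun p ?M. Lp_norm p ?M u \<le> R}.
        \<phi> u = \<phi> v \<longrightarrow> Lp_norm p ?M (\<lambda>x. correlation E g u x - correlation E g v x) < e)"
    using fin close unfolding B_def by blast
qed

lemma correlation_diff_kernel:
  fixes k h :: "'a::euclidean_space \<Rightarrow> real"
  assumes p: "1 \<le> p" and E: "E \<in> sets lebesgue" and u: "u \<in> Lp_fun p (lebesgue_on E)"
    and k: "integrable lebesgue k" and h: "integrable lebesgue h"
  shows "AE x in lebesgue. correlation E (\<lambda>z. k z - h z) u x = correlation E k u x - correlation E h u x"
  using AE_integrable_correlation[OF p E u k] AE_integrable_correlation[OF p E u h]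
  by eventually_elim (simp add: correlation_def right_diff_distrib)

text \<open>Correlation operators are compact: Young's inequality turns the \<open>L\<^sup>1\<close> approximation of the kernel by Lipschitz
  kernels into an approximation in operator norm.\<close>

theorem Lp_precompact_on_correlation:
  fixes k :: "'a::euclidean_space \<Rightarrow> real"
  assumes p: "1 \<le> p" and E: "E \<in> sets lebesgue" "bounded E" and k: "integrable lebesgue k"
  shows "Lp_precompact_on p (lebesgue_on E) (correlation E k)
    {u \<in> Lp_fun p (lebesgue_on E). Lp_norm p (lebesgue_on E) u \<le> R}"
proof (rule Lp_precompact_on_limit[OF p])
  let ?M = "lebesgue_on E"
  let ?B = "{u \<in> Lp_fun p ?M. Lp_norm p ?M u \<le> R}"
  show "correlation E k u \<in> Lp_fun p ?M" if "u \<in> ?B" for u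
    using correlation_in_Lp[OF p E(1) _ k] that by blast
  fix e :: real assume "e > 0"
  then have "e / (\<bar>R\<bar> + 1) > 0" by simp
  from lipschitz_dense_in_L1[OF k this] obtain g L where g: "L-lipschitz_on UNIV g" "integrable lebesgue g"
    and kg: "(\<integral>x. \<bar>k x - g x\<bar> \<partial>lebesgue) < e / (\<bar>R\<bar> + 1)" by blast
  have "Lp_norm p ?M (\<lambda>x. correlation E k u x - correlation E g u x) \<le> e" if "u \<in> ?B" for u
  proof -
    have u: "u \<in> Lp_fun p ?M" "Lp_norm p ?M u \<le> R" using that by auto
    have ikg: "integrable lebesgue (\<lambda>z. k z - g z)" using k g(2) by simp
    have "AE x in ?M. correlation E (\<lambda>z. k z - g z) u x = correlation E k u x - correlation E g u x"
      using correlation_diff_kernel[OF p E(1) u(1) k g(2)] E(1)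
      by (subst AE_restrict_space_iff) (auto elim: eventually_mono)
    then have "Lp_norm p ?M (\<lambda>x. correlation E k u x - correlation E g u x)
        = Lp_norm p ?M (correlation E (\<lambda>z. k z - g z) u)"
      by (intro Lp_norm_cong_AE Lp_fun_diff[OF p] correlation_in_Lp[OF p E(1) u(1)] k g(2) ikg)
        (auto elim: eventually_mono)
    also have "\<dots> \<le> (\<integral>z. \<bar>k z - g z\<bar> \<partial>lebesgue) * Lp_norm p ?M u"
      by (rule Young_correlation[OF p E(1) u(1) ikg])
    also have "\<dots> \<le> e / (\<bar>R\<bar> + 1) * (\<bar>R\<bar> + 1)"
      using kg u(2) \<open>e > 0\<close> by (intro mult_mono) auto
    finally show ?thesis by simp
  qed
  then show "\<exists>S. Lp_precompact_on p ?M S ?B \<and>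
      (\<forall>u\<in>?B. S u \<in> Lp_fun p ?M \<and> Lp_norm p ?M (\<lambda>x. correlation E k u x - S u x) \<le> e)"
    using Lp_precompact_on_lipschitz_correlation[OF p E g] correlation_in_Lp[OF p E(1) _ g(2)]
    by (intro exI[of _ "correlation E g"]) auto
qed

section \<open>The nonlocal derivative\<close>

lemma lebesgue_integral_translation:
  fixes k :: "'a::euclidean_space \<Rightarrow> real"
  assumes k: "integrable lebesgue k"
  shows "integrable lebesgue (\<lambda>y. k (y - a))" and "(\<integral>y. k (y - a) \<partial>lebesgue) = (\<integral>z. k z \<partial>lebesgue)"
proof -
  obtain h where h [measurable]: "h \<in> borel_measurable borel" and kh: "AE y in lebesgue. h y = k y"
    using completion_ex_borel_measurable_real[OF borel_measurable_integrable[OF k]]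
    by (auto simp: eq_commute dest: AE_completion)
  have cm: "w \<in> borel_measurable borel \<Longrightarrow> w \<in> borel_measurable lebesgue" for w :: "'a \<Rightarrow> real"
    by (rule measurable_completion) simp
  have ha: "(\<lambda>y. h (y - a)) \<in> borel_measurable borel" by measurable
  have kha: "AE y in lebesgue. h (y - a) = k (y - a)" by (rule AE_lebesgue_translation[OF kh])
  have ka: "(\<lambda>y. k (y - a)) \<in> borel_measurable lebesgue"
    by (rule borel_measurable_AE[OF cm[OF ha] kha])
  have hk: "integrable lebesgue h" "integral\<^sup>L lebesgue h = integral\<^sup>L lebesgue k"
    using integrable_cong_AE[OF cm[OF h] borel_measurable_integrable[OF k] kh] k
      integral_cong_AE[OF cm[OF h] borel_measurable_integrable[OF k] kh] by auto
  have tr: "integrable lborel (\<lambda>y. h (y - a))" "(\<integral>y. h (y - a) \<partial>lborel) = (\<integral>y. h y \<partial>lborel)"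
    using lborel_translation[OF ha, of a] hk(1) by (simp_all add: integrable_completion)
  show "integrable lebesgue (\<lambda>y. k (y - a))"
    using integrable_cong_AE[OF cm[OF ha] ka kha] tr(1) ha by (simp add: integrable_completion)
  have "(\<integral>y. k (y - a) \<partial>lebesgue) = (\<integral>y. h (y - a) \<partial>lebesgue)"
    by (rule integral_cong_AE[OF cm[OF ha] ka kha, symmetric])
  also have "\<dots> = integral\<^sup>L lebesgue h" using tr(2) ha h by (simp add: integral_completion)
  finally show "(\<integral>y. k (y - a) \<partial>lebesgue) = (\<integral>z. k z \<partial>lebesgue)" using hk(2) by simp
qed

text \<open>The extended domain is the Minkowski sum of \<open>\<Omega>\<close> and a closed ball, which is open because \<open>\<Omega>\<close> is.\<close>

lemma extended_domain_props:
  fixes \<Omega> :: "'a::euclidean_space set"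
  assumes "open \<Omega>" "bounded \<Omega>" "\<delta> > 0"
  shows "open (extended_domain \<delta> \<Omega>)" "bounded (extended_domain \<delta> \<Omega>)" "\<Omega> \<subseteq> extended_domain \<delta> \<Omega>"
    and "\<And>x. x \<in> \<Omega> \<Longrightarrow> ball x \<delta> \<subseteq> extended_domain \<delta> \<Omega>"
proof -
  have eq: "extended_domain \<delta> \<Omega> = (\<Union>x\<in>\<Omega>. cball x \<delta>)"
    using assms(3) by (force simp: extended_domain_def collar_def)
  also have "\<dots> = (\<Union>x\<in>\<Omega>. \<Union>y\<in>cball 0 \<delta>. {x + y})"
  proof (intro SUP_cong refl)
    fix x :: 'a
    have "y \<in> (\<Union>z\<in>cball 0 \<delta>. {x + z})" if "y \<in> cball x \<delta>" for y
      using that by (intro UN_I[of "y - x"]) (auto simp: dist_norm norm_minus_commute)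
    then show "cball x \<delta> = (\<Union>y\<in>cball 0 \<delta>. {x + y})" by (auto simp: dist_norm)
  qed
  finally have eq2: "extended_domain \<delta> \<Omega> = (\<Union>x\<in>\<Omega>. \<Union>y\<in>cball 0 \<delta>. {x + y})" .
  show "open (extended_domain \<delta> \<Omega>)" unfolding eq2 using assms(1) by (intro open_sums) auto
  show "bounded (extended_domain \<delta> \<Omega>)" unfolding eq2 using assms(2) by (intro bounded_sums) auto
  show "\<Omega> \<subseteq> extended_domain \<delta> \<Omega>" by (auto simp: extended_domain_def)
  show "ball x \<delta> \<subseteq> extended_domain \<delta> \<Omega>" if "x \<in> \<Omega>" for x
    using that ball_subset_cball[of x \<delta>] unfolding eq by blast
qed

text \<open>Integrability allows the integral to be split. For \<open>u\<close> in \<open>L\<^sup>p\<close> it fails at most on a null set of \<open>x\<close>; at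
  such points of \<open>\<Omega>\<close> both integrals are 0 by convention and the equation need not hold.\<close>

lemma nonlocal_deriv_eq_correlation:
  fixes \<Omega> :: "'a::euclidean_space set" and \<mu> :: "'a \<Rightarrow> real"
  assumes \<Omega>: "open \<Omega>" "bounded \<Omega>" "\<delta> > 0" and \<mu>: "integrable lebesgue \<mu>"
  defines "k \<equiv> \<lambda>z. indicator (ball 0 \<delta>) z * \<mu> z"
  assumes int: "integrable lebesgue (\<lambda>y. indicator (extended_domain \<delta> \<Omega>) y * u y * k (y - x))"
  shows "nonlocal_deriv \<delta> \<Omega> \<mu> u x =
    indicator \<Omega> x * (correlation (extended_domain \<delta> \<Omega>) k u x - (LINT z:ball 0 \<delta>|lebesgue. \<mu> z) * u x)"
proof (cases "x \<in> \<Omega>")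
  case False
  then show ?thesis by (simp add: nonlocal_deriv_def set_lebesgue_integral_def)
next
  case True
  let ?E = "extended_domain \<delta> \<Omega>"
  have k: "integrable lebesgue k"
    unfolding k_def using integrable_mult_indicator[OF _ \<mu>, of "ball 0 \<delta>"] by simp
  have "nonlocal_deriv \<delta> \<Omega> \<mu> u x
      = (\<integral>y. (indicator ?E y * u y * k (y - x) - u x * k (y - x)) \<partial>lebesgue)"
    unfolding nonlocal_deriv_def set_lebesgue_integral_def
  proof (rule Bochner_Integration.integral_cong[OF refl])
    fix y
    have "y \<in> ball x \<delta> \<longleftrightarrow> y - x \<in> ball 0 \<delta>" by (simp add: dist_norm norm_minus_commute)
    moreover have "y \<in> ?E" if "y \<in> ball x \<delta>"
      using extended_domain_props(4)[OF \<Omega> True] that by blast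
    ultimately show "indicator ?E y *\<^sub>R ((u y - u x) * \<mu> (y - x) * indicator (ball x \<delta>) y * indicator \<Omega> x)
        = indicator ?E y * u y * k (y - x) - u x * k (y - x)"
      using True by (auto simp: k_def indicator_def algebra_simps)
  qed
  also have "\<dots> = correlation ?E k u x - u x * (\<integral>z. k z \<partial>lebesgue)"
    using int lebesgue_integral_translation[OF k, of x] by (simp add: correlation_def)
  also have "(\<integral>z. k z \<partial>lebesgue) = (LINT z:ball 0 \<delta>|lebesgue. \<mu> z)"
    by (simp add: k_def set_lebesgue_integral_def)
  finally show ?thesis using True by simp
qed

lemma Lp_fun_cong_AE_lebesgue_on:
  fixes u v :: "'a::euclidean_space \<Rightarrow> real"
  assumes E: "E \<in> sets lebesgue" and u: "u \<in> Lp_fun p (lebesgue_on E)"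
    and eq: "AE x in lebesgue_on E. u x = v x"
  shows "v \<in> Lp_fun p (lebesgue_on E)"
proof -
  have Eu: "(\<lambda>x. indicator E x * u x) \<in> borel_measurable lebesgue"
    "integrable lebesgue (\<lambda>x. \<bar>indicator E x * u x\<bar> powr p)"
    using u by (simp_all add: Lp_fun_lebesgue_on_iff[OF E])
  have "AE x in lebesgue. x \<in> E \<longrightarrow> u x = v x" using eq E by (subst (asm) AE_restrict_space_iff) auto
  then have ae: "AE x in lebesgue. indicator E x * u x = indicator E x * v x"
    by eventually_elim (auto simp: indicator_def)
  have Ev: "(\<lambda>x. indicator E x * v x) \<in> borel_measurable lebesgue" by (rule borel_measurable_AE[OF Eu(1) ae])
  have "AE x in lebesgue. \<bar>indicator E x * u x\<bar> powr p = \<bar>indicator E x * v x\<bar> powr p"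
    using ae by eventually_elim (simp only:)
  then have "integrable lebesgue (\<lambda>x. \<bar>indicator E x * v x\<bar> powr p)"
    using Eu Ev by (subst (asm) integrable_cong_AE) auto
  then show ?thesis using Ev by (simp add: Lp_fun_lebesgue_on_iff[OF E])
qed

lemma Lp_fun_mult_indicator:
  assumes p: "1 \<le> p" and E: "E \<in> sets lebesgue" and S: "S \<in> sets lebesgue"
    and u: "u \<in> Lp_fun p (lebesgue_on E)"
  shows "(\<lambda>x. indicator S x * u x) \<in> Lp_fun p (lebesgue_on E)"
    and "Lp_norm p (lebesgue_on E) (\<lambda>x. indicator S x * u x) \<le> Lp_norm p (lebesgue_on E) u"
proof -
  have "(indicator S :: 'a \<Rightarrow> real) \<in> borel_measurable (lebesgue_on E)"
    using S by (intro measurable_restrict_space1) simp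
  then have m: "(\<lambda>x. indicator S x * u x) \<in> borel_measurable (lebesgue_on E)" using u by (auto simp: Lp_fun_def)
  show "(\<lambda>x. indicator S x * u x) \<in> Lp_fun p (lebesgue_on E)"
    "Lp_norm p (lebesgue_on E) (\<lambda>x. indicator S x * u x) \<le> Lp_norm p (lebesgue_on E) u"
    by (rule Lp_norm_le_of_abs_le[OF p m u]; simp add: indicator_def)+
qed

text \<open>Linearity and the invariance under changes on null sets hold for the right-hand side of the first claim; they
  transfer to the derivative because the two sides agree almost everywhere.\<close>

lemma
  fixes \<Omega> :: "'a::euclidean_space set" and \<mu> :: "'a \<Rightarrow> real"
  assumes \<Omega>: "open \<Omega>" "bounded \<Omega>" "\<delta> > 0" and \<mu>: "integrable lebesgue \<mu>" and p: "1 \<le> p"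
  defines "k \<equiv> \<lambda>z. indicator (ball 0 \<delta>) z * \<mu> z" and "c \<equiv> (LINT z:ball 0 \<delta>|lebesgue. \<mu> z)"
    and "E \<equiv> extended_domain \<delta> \<Omega>"
  shows nonlocal_deriv_AE_eq: "\<And>u. u \<in> Lp_fun p (lebesgue_on E) \<Longrightarrow>
      AE x in lebesgue_on E. nonlocal_deriv \<delta> \<Omega> \<mu> u x = indicator \<Omega> x * (correlation E k u x - c * u x)"
    and Lp_linear_operator_nonlocal_deriv: "Lp_linear_operator p (lebesgue_on E) (nonlocal_deriv \<delta> \<Omega> \<mu>)"
proof -
  let ?M = "lebesgue_on E" and ?D = "nonlocal_deriv \<delta> \<Omega> \<mu>"
  have E: "E \<in> sets lebesgue" using extended_domain_props(1)[OF \<Omega>] by (simp add: E_def borel_open)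
  have \<Omega>m: "\<Omega> \<in> sets lebesgue" using \<Omega>(1) by (simp add: borel_open)
  have k: "integrable lebesgue k"
    unfolding k_def using integrable_mult_indicator[OF _ \<mu>, of "ball 0 \<delta>"] by simp
  have AE_M: "AE x in ?M. Q x" if "AE x in lebesgue. Q x" for Q
    using that E by (subst AE_restrict_space_iff) (auto elim: eventually_mono)
  have eq: "AE x in ?M. ?D u x = indicator \<Omega> x * (correlation E k u x - c * u x)"
    if u: "u \<in> Lp_fun p ?M" for u
    using AE_M[OF AE_integrable_correlation[OF p E u k]]
    by eventually_elim
      (use nonlocal_deriv_eq_correlation[OF \<Omega> \<mu>] in \<open>simp add: k_def E_def c_def\<close>)
  then show "\<And>u. u \<in> Lp_fun p ?M \<Longrightarrow>
      AE x in ?M. ?D u x = indicator \<Omega> x * (correlation E k u x - c * u x)" .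
  show "Lp_linear_operator p ?M ?D"
    unfolding Lp_linear_operator_def
  proof (intro conjI ballI allI impI)
    fix u assume u: "u \<in> Lp_fun p ?M"
    have "(\<lambda>x. indicator \<Omega> x * (correlation E k u x - c * u x)) \<in> Lp_fun p ?M"
      by (intro Lp_fun_mult_indicator[OF p E \<Omega>m] Lp_fun_diff[OF p] correlation_in_Lp[OF p E u k] Lp_fun_scale u)
    then show "?D u \<in> Lp_fun p ?M"
      by (rule Lp_fun_cong_AE_lebesgue_on[OF E]) (use eq[OF u] in \<open>auto elim: eventually_mono\<close>)
    show "AE x in ?M. ?D (\<lambda>y. a * u y) x = a * ?D u x" for a
      using eq[OF u] eq[OF Lp_fun_scale[OF u, of a]]
    proof eventually_elim
      case (elim x)
      have "correlation E k (\<lambda>y. a * u y) x = a * correlation E k u x"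
        unfolding correlation_def by (subst integral_mult_right_zero[symmetric]) (simp add: ac_simps)
      then show ?case unfolding elim by (simp add: algebra_simps)
    qed
    fix v assume v: "v \<in> Lp_fun p ?M"
    show "AE x in ?M. ?D u x = ?D v x" if uv: "AE x in ?M. u x = v x"
    proof -
      have "AE y in lebesgue. y \<in> E \<longrightarrow> u y = v y" using uv E by (subst (asm) AE_restrict_space_iff) auto
      then have "AE y in lebesgue. indicator E y * u y * k (y - x) = indicator E y * v y * k (y - x)" for x
        by eventually_elim (auto simp: indicator_def)
      then have "correlation E k u x = correlation E k v x" for x
        unfolding correlation_def
        by (intro integral_cong_AE correlation_integrand_measurable[OF p E _ k] u v)
      then show ?thesis using eq[OF u] eq[OF v] uv by (auto elim!: eventually_elim2)
    qed
    show "AE x in ?M. ?D (\<lambda>y. u y + v y) x = ?D u x + ?D v x"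
      using eq[OF u] eq[OF v] eq[OF Lp_fun_add[OF p u v]]
        AE_M[OF AE_integrable_correlation[OF p E u k]] AE_M[OF AE_integrable_correlation[OF p E v k]]
    proof eventually_elim
      case (elim x)
      have "correlation E k (\<lambda>y. u y + v y) x = correlation E k u x + correlation E k v x"
        using elim(4,5) by (simp add: correlation_def distrib_left distrib_right)
      then show ?case using elim(1-3) by (simp add: algebra_simps)
    qed
  qed
qed

text \<open>The functions are the normalised indicators of the annuli between the radii \<open>r / (n + 2)\<close> and
  \<open>r / (n + 1)\<close> around a point of \<open>\<Omega>\<close>. Open nonempty sets have positive measure, so normalising is possible.\<close>

lemma unit_functions_disjoint_supports:
  fixes \<Omega> :: "'a::euclidean_space set"
  assumes p: "1 \<le> p" and \<Omega>: "open \<Omega>" "\<Omega> \<noteq> {}" and E: "E \<in> sets lebesgue" "\<Omega> \<subseteq> E"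
  obtains w :: "nat \<Rightarrow> 'a \<Rightarrow> real"
  where "\<And>n. w n \<in> Lp_fun p (lebesgue_on E)" "\<And>n. Lp_norm p (lebesgue_on E) (w n) = 1"
    "\<And>n x. x \<notin> \<Omega> \<Longrightarrow> w n x = 0" "\<And>m n x. m \<noteq> n \<Longrightarrow> w m x = 0 \<or> w n x = 0"
proof -
  obtain a r where r: "r > 0" "ball a r \<subseteq> \<Omega>"
    using \<Omega> by (meson all_not_in_conv openE)
  define A where "A n = {x. r / (real n + 2) < dist a x \<and> dist a x < r / (real n + 1)}" for n
  have A\<Omega>: "A n \<subseteq> \<Omega>" for n
  proof
    fix x assume "x \<in> A n"
    moreover have "r / (real n + 1) \<le> r" using r(1) by (simp add: field_simps)
    ultimately have "x \<in> ball a r" by (simp add: A_def)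
    then show "x \<in> \<Omega>" using r(2) by blast
  qed
  have disj: "A m \<inter> A n = {}" if "m \<noteq> n" for m n
  proof -
    have *: "A m \<inter> A n = {}" if "m < n" for m n
    proof -
      have "r / (real n + 1) \<le> r / (real m + 2)" using that r(1) by (intro divide_left_mono) auto
      then show ?thesis by (auto simp: A_def)
    qed
    show ?thesis using *[of m n] *[of n m] that by (cases "m < n") auto
  qed
  have A_open: "open (A n)" for n
    unfolding A_def by (intro open_Collect_conj open_Collect_less continuous_intros)
  have A_ne: "A n \<noteq> {}" for n
  proof -
    obtain b :: 'a where b: "b \<in> Basis" using nonempty_Basis by blast
    have "r / (real n + 2) < r / (real n + 1)" using r(1) by (intro divide_strict_left_mono) auto
    then obtain t where t: "r / (real n + 2) < t" "t < r / (real n + 1)" using dense by blast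
    have "t > 0" using t(1) r(1) by (smt (verit) divide_pos_pos of_nat_0_le_iff)
    then have "a + t *\<^sub>R b \<in> A n" using t b by (simp add: A_def dist_norm)
    then show ?thesis by blast
  qed
  have Am: "A n \<in> lmeasurable" for n
  proof -
    have "A n \<subseteq> cball a (r / (real n + 1))" by (auto simp: A_def)
    then show ?thesis using A_open bounded_subset[OF bounded_cball] by (intro lmeasurable_open) auto
  qed
  define V where "V n = measure lebesgue (A n)" for n
  have V: "V n > 0" for n
    using open_not_negligible[OF A_open A_ne, of n] Am[of n] measure_nonneg[of lebesgue "A n"]
    by (auto simp: V_def negligible_iff_measure less_le)
  define w where "w n x = indicator (A n) x * V n powr (- 1 / p)" for n and x :: 'a
  have w_meas: "w n \<in> borel_measurable lebesgue" for n
    unfolding w_def using fmeasurableD[OF Am] by simp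
  have wp: "\<bar>indicator E x * w n x\<bar> powr p = indicator (A n) x * (1 / V n)" for n x
  proof (cases "x \<in> A n")
    case True
    have "(V n powr (- 1 / p)) powr p = V n powr (- 1)" using p by (simp add: powr_powr)
    also have "\<dots> = 1 / V n" using V[of n] by (simp add: powr_minus divide_inverse)
    finally have "(V n powr (- 1 / p)) powr p = 1 / V n" .
    then show ?thesis using True A\<Omega>[of n] E(2) by (auto simp: w_def)
  qed (simp add: w_def)
  have iA: "integrable lebesgue (indicator (A n) :: 'a \<Rightarrow> real)" for n
    using Am[of n] by (auto simp: integrable_indicator_iff fmeasurable_def)
  show ?thesis
  proof (rule that)
    show "w n \<in> Lp_fun p (lebesgue_on E)" for n
      unfolding Lp_fun_lebesgue_on_iff[OF E(1)] wp using w_meas E(1) iA by auto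
    show "Lp_norm p (lebesgue_on E) (w n) = 1" for n
      unfolding Lp_norm_lebesgue_on[OF E(1)] wp
      using fmeasurableD[OF Am[of n]] V[of n] by (simp add: V_def)
    show "w n x = 0" if "x \<notin> \<Omega>" for n x
      using that A\<Omega>[of n] by (auto simp: w_def indicator_def)
    show "w m x = 0 \<or> w n x = 0" if "m \<noteq> n" for m n x
      using disj[OF that] by (auto simp: w_def indicator_def)
  qed
qed

theorem theorem4p1:
  fixes \<Omega> :: "'a::euclidean_space set" and \<delta> p :: real and \<mu> :: "'a \<Rightarrow> real"
  assumes "\<Omega> \<noteq> {}" and "open \<Omega>" and "bounded \<Omega>"
    and "\<delta> > 0"
    and "integrable lebesgue \<mu>"
    and "ess_support \<mu> \<subseteq> cball 0 \<delta>"
    and "1 \<le> p"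
  shows "Lp_linear_operator p (lebesgue_on (extended_domain \<delta> \<Omega>)) (nonlocal_deriv \<delta> \<Omega> \<mu>) \<and>
         (Lp_compact_operator p (lebesgue_on (extended_domain \<delta> \<Omega>)) (nonlocal_deriv \<delta> \<Omega> \<mu>)
            \<longleftrightarrow> (LINT z:ball 0 \<delta>|lebesgue. \<mu> z) = 0)"
proof -
  note \<Omega> = assms(2,3,4) and \<mu> = assms(5) and p = assms(7)
  define E where "E = extended_domain \<delta> \<Omega>"
  define k where "k z = indicator (ball 0 \<delta>) z * \<mu> z" for z
  define c where "c = (LINT z:ball 0 \<delta>|lebesgue. \<mu> z)"
  let ?M = "lebesgue_on E" and ?D = "nonlocal_deriv \<delta> \<Omega> \<mu>"
  define K where "K u x = indicator \<Omega> x * correlation E k u x" for u x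
  have E: "E \<in> sets lebesgue" "bounded E" "\<Omega> \<subseteq> E"
    using extended_domain_props[OF \<Omega>] by (simp_all add: E_def borel_open)
  have \<Omega>m: "\<Omega> \<in> sets lebesgue" using \<Omega>(1) by (simp add: borel_open)
  have k: "integrable lebesgue k"
    unfolding k_def using integrable_mult_indicator[OF _ \<mu>, of "ball 0 \<delta>"] by simp
  have lin: "Lp_linear_operator p ?M ?D"
    unfolding E_def by (rule Lp_linear_operator_nonlocal_deriv[OF \<Omega> \<mu> p])
  have D_Lp: "?D u \<in> Lp_fun p ?M" if "u \<in> Lp_fun p ?M" for u
    using lin that by (simp add: Lp_linear_operator_def)
  have D_eq: "AE x in ?M. ?D u x = K u x - indicator \<Omega> x * (c * u x)" if "u \<in> Lp_fun p ?M" for u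
    using nonlocal_deriv_AE_eq[OF \<Omega> \<mu> p, of u] that
    unfolding E_def k_def[abs_def] K_def c_def by (simp add: right_diff_distrib)
  have corr_Lp: "correlation E k u \<in> Lp_fun p ?M" if "u \<in> Lp_fun p ?M" for u
    by (rule correlation_in_Lp[OF p E(1) that k])
  have K_Lp: "K u \<in> Lp_fun p ?M" if "u \<in> Lp_fun p ?M" for u
    unfolding K_def by (rule Lp_fun_mult_indicator[OF p E(1) \<Omega>m corr_Lp[OF that]])
  have K_pre: "Lp_precompact_on p ?M K {u \<in> Lp_fun p ?M. Lp_norm p ?M u \<le> R}" for R
  proof (rule Lp_precompact_on_dominated[OF Lp_precompact_on_correlation[OF p E(1,2) k]])
    fix u v assume uv: "u \<in> {u \<in> Lp_fun p ?M. Lp_norm p ?M u \<le> R}" "v \<in> {u \<in> Lp_fun p ?M. Lp_norm p ?M u \<le> R}"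
    have "Lp_norm p ?M (\<lambda>x. indicator \<Omega> x * (correlation E k u x - correlation E k v x))
        \<le> Lp_norm p ?M (\<lambda>x. correlation E k u x - correlation E k v x)"
      using uv by (intro Lp_fun_mult_indicator[OF p E(1) \<Omega>m] Lp_fun_diff[OF p] corr_Lp) auto
    then show "Lp_norm p ?M (\<lambda>x. K u x - K v x) \<le> Lp_norm p ?M (\<lambda>x. correlation E k u x - correlation E k v x)"
      by (simp add: K_def right_diff_distrib)
  qed
  have "Lp_compact_operator p ?M ?D \<longleftrightarrow> c = 0"
  proof
    assume c: "c = 0"
    have "Lp_precompact_on p ?M ?D {u \<in> Lp_fun p ?M. Lp_norm p ?M u \<le> R}" for R
    proof (rule Lp_precompact_on_dominated[OF K_pre])
      fix u v assume "u \<in> {u \<in> Lp_fun p ?M. Lp_norm p ?M u \<le> R}" "v \<in> {u \<in> Lp_fun p ?M. Lp_norm p ?M u \<le> R}"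
      then have uv: "u \<in> Lp_fun p ?M" "v \<in> Lp_fun p ?M" by auto
      have "AE x in ?M. ?D u x - ?D v x = K u x - K v x"
        using D_eq[OF uv(1)] D_eq[OF uv(2)] by eventually_elim (simp add: c)
      then have "Lp_norm p ?M (\<lambda>x. ?D u x - ?D v x) = Lp_norm p ?M (\<lambda>x. K u x - K v x)"
        by (intro Lp_norm_cong_AE Lp_fun_diff[OF p] D_Lp K_Lp uv)
      then show "Lp_norm p ?M (\<lambda>x. ?D u x - ?D v x) \<le> Lp_norm p ?M (\<lambda>x. K u x - K v x)" by simp
    qed
    then show "Lp_compact_operator p ?M ?D" using Lp_compact_operator_iff[OF p lin] by blast
  next
    assume "Lp_compact_operator p ?M ?D"
    then have D_pre: "Lp_precompact_on p ?M ?D {u \<in> Lp_fun p ?M. Lp_norm p ?M u \<le> 1}"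
      using Lp_compact_operator_iff[OF p lin] by blast
    define J where "J u x = indicator \<Omega> x * (c * u x)" for u x
    have J_Lp: "J u \<in> Lp_fun p ?M" if "u \<in> Lp_fun p ?M" for u
      unfolding J_def by (intro Lp_fun_mult_indicator(1)[OF p E(1) \<Omega>m] Lp_fun_scale that)
    have J_pre: "Lp_precompact_on p ?M J {u \<in> Lp_fun p ?M. Lp_norm p ?M u \<le> 1}"
    proof (rule Lp_precompact_on_diff[OF p K_pre D_pre])
      fix u assume "u \<in> {u \<in> Lp_fun p ?M. Lp_norm p ?M u \<le> 1}"
      then have u: "u \<in> Lp_fun p ?M" by simp
      show "K u \<in> Lp_fun p ?M" "?D u \<in> Lp_fun p ?M" "J u \<in> Lp_fun p ?M" using K_Lp D_Lp J_Lp u by auto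
      show "AE x in ?M. J u x = K u x - ?D u x" using D_eq[OF u] by eventually_elim (simp add: J_def)
    qed
    obtain w :: "nat \<Rightarrow> 'a \<Rightarrow> real" where w: "\<And>n. w n \<in> Lp_fun p ?M" "\<And>n. Lp_norm p ?M (w n) = 1"
      and supp: "\<And>n x. x \<notin> \<Omega> \<Longrightarrow> w n x = 0" and disj: "\<And>m n x. m \<noteq> n \<Longrightarrow> w m x = 0 \<or> w n x = 0"
      using unit_functions_disjoint_supports[OF p \<Omega>(1) assms(1) E(1,3)] by metis
    have sep: "\<bar>c\<bar> \<le> Lp_norm p ?M (\<lambda>x. J (w m) x - J (w n) x)" if "m \<noteq> n" for m n
    proof -
      have "\<bar>c\<bar> = Lp_norm p ?M (\<lambda>x. c * w m x)" using w(2)[of m] by (simp add: Lp_norm_scale[OF p])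
      also have "\<dots> \<le> Lp_norm p ?M (\<lambda>x. J (w m) x - J (w n) x)"
      proof (rule Lp_norm_le_of_abs_le(2)[OF p])
        show "(\<lambda>x. c * w m x) \<in> borel_measurable ?M" using w(1)[of m] by (auto simp: Lp_fun_def)
        show "(\<lambda>x. J (w m) x - J (w n) x) \<in> Lp_fun p ?M" by (intro Lp_fun_diff[OF p] J_Lp w)
        show "\<bar>c * w m x\<bar> \<le> \<bar>J (w m) x - J (w n) x\<bar>" for x
          using supp[of x m] disj[OF that, of x] by (cases "x \<in> \<Omega>") (auto simp: J_def)
      qed
      finally show ?thesis .
    qed
    show "c = 0"
    proof (rule ccontr)
      assume "c \<noteq> 0"
      then have "\<bar>c\<bar> > 0" by simp
      then show False using w by (intro Lp_precompact_on_separated[OF J_pre, of w "\<bar>c\<bar>"] sep) auto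
    qed
  qed
  then show ?thesis using lin by (simp add: E_def c_def)
qed

end
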